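(* $\mathsf{FindWS}_{\boldsymbol\Delta}\equiv_{\mathrm W}\mathsf{Det}_{\boldsymbol\Delta}\equiv_{\mathrm W}\mathsf{FindWS}_{\boldsymbol\Sigma}\equiv_{\mathrm W}\mathsf{UC}_{\mathbb{N}^\mathbb{N}}$.
   Context: A represented space is a set $X$ with a partial surjection $\delta_X:\subseteq\mathbb{N}^\mathbb{N}\to X$ (names). A partial $F$ realizes a partial multivalued $f:\subseteq X\rightrightarrows Y$ if for every $x\in\operatorname{dom}(f)$ and name $p$ of $x$, $F(p)$ names an element of $f(x)$. $f\le_{\mathrm W}g$ if there are computable partial $H,K:\subseteq\mathbb{N}^\mathbb{N}\to\mathbb{N}^\mathbb{N}$ such that for every realizer $G$ of $g$, $p\mapsto K(\langle p,G(H(p))\rangle)$ realizes $f$; $\equiv_{\mathrm W}$ is mutual reducibility. $\mathsf{UC}_{\mathbb{N}^\mathbb{N}}$: given (the characteristic function of) a tree $T\subseteq\mathbb{N}^{<\mathbb{N}}$ whose set of infinite paths is a singleton $\{x\}$, output $x$. $\mathcal{O}(\mathbb{N}^\mathbb{N})$ is the space of open $U\subseteq\mathbb{N}^\mathbb{N}$, a name being an enumeration of finite strings $w_0,w_1,\dots$ (possibly with a placeholder for "nothing") with $U=\bigcup_i w_i\mathbb{N}^\mathbb{N}$. $\Delta^0_1(\mathbb{N}^\mathbb{N})$ is the space of clopen sets, a name of $W$ being a pair of $\mathcal{O}$-names of $W$ and of $\mathbb{N}^\mathbb{N}\setminus W$. For $W\subseteq\mathbb{N}^\mathbb{N}$,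 the game $G(W)$: Players 1 and 2 alternately choose natural numbers, Player 1 first, producing $x\in\mathbb{N}^\mathbb{N}$; Player 1 wins iff $x\in W$. Strategies are functions from finite sequences to $\mathbb{N}$, coded as elements of $\mathbb{N}^\mathbb{N}$. $\mathsf{FindWS}_{\boldsymbol\Sigma}:\subseteq\mathcal{O}(\mathbb{N}^\mathbb{N})\rightrightarrows\mathbb{N}^\mathbb{N}$ maps each open $W$ for which Player 2 has no winning strategy in $G(W)$ to the set of winning strategies of Player 1. $\mathsf{FindWS}_{\boldsymbol\Delta}:\subseteq\Delta^0_1(\mathbb{N}^\mathbb{N})\rightrightarrows\mathbb{N}^\mathbb{N}$ does the same for clopen $W$. $\mathsf{Det}_{\boldsymbol\Delta}:\Delta^0_1(\mathbb{N}^\mathbb{N})\rightrightarrows\mathbb{N}^\mathbb{N}\times\mathbb{N}^\mathbb{N}$ maps a clopen $W$ to all pairs $(\sigma,\tau)$ of strategies for Player 1 and Player 2 respectively such that either $\sigma$ is winning for Player 1 or $\tau$ is winning for Player 2 in $G(W)$. *)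

theory Defs
  imports "HOL-Analysis.Function_Topology" "HOL-Library.Nat_Bijection"
begin

type_synonym baire = "nat \<Rightarrow> nat"

section \<open>Type-2 computability\<close>

text \<open>
  Terms for the partial recursive functions relative to an oracle.  Application to an
  argument list of unsuitable length is undefined.
\<close>

datatype orec =
    Zero
  | Succ
  | Proj nat
  | Oracle
  | Comp orec "orec list"
  | PrimRec orec orec
  | Mu orec

fun eval :: "orec \<Rightarrow> baire \<Rightarrow> nat list \<Rightarrow> nat option" where
  "eval Zero p xs = Some 0"
| "eval Succ p xs = (case xs of [x] \<Rightarrow> Some (Suc x) | _ \<Rightarrow> None)"
| "eval (Proj i) p xs = (if i < length xs then Some (xs ! i) else None)"
| "eval Oracle p xs = (case xs of [x] \<Rightarrow> Some (p x) | _ \<Rightarrow> None)"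
| "eval (Comp f gs) p xs =
     Option.bind (those (map (\<lambda>g. eval g p xs) gs)) (\<lambda>ys. eval f p ys)"
| "eval (PrimRec f g) p xs =
     (case xs of
        [] \<Rightarrow> None
      | n # ys \<Rightarrow> rec_nat (eval f p ys) (\<lambda>k r. Option.bind r (\<lambda>v. eval g p (k # v # ys))) n)"
| "eval (Mu f) p xs =
     (if \<exists>n. eval f p (n # xs) = Some 0 \<and> (\<forall>m<n. eval f p (m # xs) \<noteq> None)
      then Some (LEAST n. eval f p (n # xs) = Some 0) else None)"

text \<open>
  The domain of a computable partial function need not be the maximal one on which the
  underlying program produces an infinite output, i.e. restrictions of computable functions
  are computable.
\<close>

definition computable :: "(baire \<rightharpoonup> baire) \<Rightarrow> bool" where
  "computable F \<longleftrightarrow> (\<exists>c. \<forall>p q. F p = Some q \<longrightarrow> (\<forall>n. eval c p [n] = Some (q n)))"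

definition bpair :: "baire \<Rightarrow> baire \<Rightarrow> baire" where
  "bpair p q = (\<lambda>n. if even n then p (n div 2) else q (n div 2))"

definition bfst :: "baire \<Rightarrow> baire" where
  "bfst r = (\<lambda>n. r (2 * n))"

definition bsnd :: "baire \<Rightarrow> baire" where
  "bsnd r = (\<lambda>n. r (2 * n + 1))"

lemma bfst_bpair [simp]: "bfst (bpair p q) = p"
  by (simp add: bfst_def bpair_def)

lemma bsnd_bpair [simp]: "bsnd (bpair p q) = q"
  by (simp add: bsnd_def bpair_def)

lemma bpair_collapse [simp]: "bpair (bfst r) (bsnd r) = r"
  by (auto simp: bpair_def bfst_def bsnd_def fun_eq_iff)


section \<open>Represented spaces and Weihrauch reducibility\<close>

text \<open>
  A represented space is given by its representation \<open>\<delta>\<close>; the underlying set is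
  \<open>ran \<delta>\<close>.
\<close>

type_synonym 'a representation = "baire \<rightharpoonup> 'a"

text \<open>
  A partial multivalued function between represented spaces.  The domain is an explicit
  component (a subset of \<open>ran (in_rep f)\<close>), so that it can be specified independently of
  whether the value sets are nonempty.
\<close>

record ('a, 'b) problem =
  in_rep :: "'a representation"
  out_rep :: "'b representation"
  inputs :: "'a set"
  solutions :: "'a \<Rightarrow> 'b set"

definition realizes :: "(baire \<rightharpoonup> baire) \<Rightarrow> ('a, 'b) problem \<Rightarrow> bool" where
  "realizes F f \<longleftrightarrow>
     (\<forall>x \<in> inputs f. \<forall>p. in_rep f p = Some x \<longrightarrow>
        (\<exists>q y. F p = Some q \<and> out_rep f q = Some y \<and> y \<in> solutions f x))"

definition weihrauch_le :: "('a, 'b) problem \<Rightarrow> ('c, 'd) problem \<Rightarrow> bool"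
    (infix "\<le>\<^sub>W" 50) where
  "f \<le>\<^sub>W g \<longleftrightarrow>
     (\<exists>H K. computable H \<and> computable K \<and>
        (\<forall>G. realizes G g \<longrightarrow>
           realizes (\<lambda>p. Option.bind (H p)
                          (\<lambda>q. Option.bind (G q) (\<lambda>r. K (bpair p r)))) f))"

definition weihrauch_eq :: "('a, 'b) problem \<Rightarrow> ('c, 'd) problem \<Rightarrow> bool"
    (infix "\<equiv>\<^sub>W" 50) where
  "f \<equiv>\<^sub>W g \<longleftrightarrow> f \<le>\<^sub>W g \<and> g \<le>\<^sub>W f"

definition baire_rep :: "baire representation" where
  "baire_rep p = Some p"

definition prod_rep :: "'a representation \<Rightarrow> 'b representation \<Rightarrow> ('a \<times> 'b) representation" where
  "prod_rep \<delta> \<delta>' r =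
     (case (\<delta> (bfst r), \<delta>' (bsnd r)) of (Some x, Some y) \<Rightarrow> Some (x, y) | _ \<Rightarrow> None)"


section \<open>Trees, open sets and clopen sets\<close>

text \<open>Finite strings are coded by natural numbers through \<^const>\<open>list_encode\<close>.\<close>

definition restr :: "baire \<Rightarrow> nat \<Rightarrow> nat list" where
  "restr x n = map x [0..<n]"

definition is_tree :: "nat list set \<Rightarrow> bool" where
  "is_tree T \<longleftrightarrow> (\<forall>u v. u @ v \<in> T \<longrightarrow> u \<in> T)"

definition tree_paths :: "nat list set \<Rightarrow> baire set" where
  "tree_paths T = {x. \<forall>n. restr x n \<in> T}"

definition tree_rep :: "nat list set representation" where
  "tree_rep p =
     (if (\<forall>n. p n \<le> 1) \<and> is_tree {w. p (list_encode w) = 1}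
      then Some {w. p (list_encode w) = 1} else None)"

definition cylinder :: "nat list \<Rightarrow> baire set" where
  "cylinder w = {x. restr x (length w) = w}"

text \<open>In an enumeration, \<open>0\<close> stands for nothing and \<open>Suc n\<close> for the string coded by \<open>n\<close>.\<close>

definition enum_open :: "baire \<Rightarrow> baire set" where
  "enum_open p = (\<Union>w \<in> {w. \<exists>i. p i = Suc (list_encode w)}. cylinder w)"

definition open_rep :: "baire set representation" where
  "open_rep p = Some (enum_open p)"

definition clopen_rep :: "baire set representation" where
  "clopen_rep r =
     (if enum_open (bsnd r) = - enum_open (bfst r) then Some (enum_open (bfst r)) else None)"

lemma ran_tree_rep: "ran tree_rep = {T. is_tree T}"
proof (intro equalityI subsetI)
  fix T assume "T \<in> {T. is_tree T}"
  then have "tree_rep (\<lambda>n. if list_decode n \<in> T then 1 else 0) = Some T"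
    by (simp add: tree_rep_def)
  then show "T \<in> ran tree_rep" unfolding ran_def by blast
next
  fix T assume "T \<in> ran tree_rep"
  then obtain p where "tree_rep p = Some T" unfolding ran_def by blast
  then have "is_tree T" unfolding tree_rep_def by (metis option.distinct(1) option.inject)
  then show "T \<in> {T. is_tree T}" by blast
qed

text \<open>
  The topology of Baire space is the product topology that the type \<^typ>\<open>baire\<close> carries by
  type class instantiation, with \<^typ>\<open>nat\<close> discrete.
\<close>

lemma mem_cylinder: "x \<in> cylinder w \<longleftrightarrow> (\<forall>i<length w. x i = w ! i)"
  unfolding cylinder_def restr_def mem_Collect_eq list_eq_iff_nth_eq[of "map x [0..<length w]"] by simp

lemma open_cylinder: "open (cylinder w)"
proof -
  have "open {x :: baire. x i = w ! i}" for i
    using product_topology_basis'[of "{i}" "\<lambda>i. {w ! i}" "\<lambda>i. i"] by (simp add: open_discrete)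
  then have "open (\<Inter>i\<in>{..<length w}. {x :: baire. x i = w ! i})"
    by (intro open_INT) auto
  also have "(\<Inter>i\<in>{..<length w}. {x :: baire. x i = w ! i}) = cylinder w"
    by (auto simp: mem_cylinder)
  finally show ?thesis .
qed

lemma open_contains_cylinder:
  assumes "open U" "x \<in> U"
  shows "\<exists>n. cylinder (restr x n) \<subseteq> U"
proof -
  have "openin (product_topology (\<lambda>i. euclidean) UNIV) U"
    using assms(1) by (simp add: open_fun_def)
  from product_topology_open_contains_basis[OF this assms(2)]
  have "\<exists>X. x \<in> (\<Pi>\<^sub>E i\<in>UNIV. X i) \<and> finite {i. X i \<noteq> (UNIV :: nat set)} \<and> (\<Pi>\<^sub>E i\<in>UNIV. X i) \<subseteq> U"
    unfolding topspace_euclidean by (elim exE conjE) (intro exI conjI)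
  then obtain X where x: "x \<in> (\<Pi>\<^sub>E i\<in>UNIV. X i)" and fin: "finite {i. X i \<noteq> (UNIV :: nat set)}"
    and sub: "(\<Pi>\<^sub>E i\<in>UNIV. X i) \<subseteq> U"
    by (elim exE conjE)
  obtain n where "\<forall>i \<in> {i. X i \<noteq> UNIV}. i < n"
    using fin unfolding finite_nat_set_iff_bounded by (rule exE)
  then have n: "X i \<noteq> UNIV \<Longrightarrow> i < n" for i
    by simp
  have "y \<in> U" if y: "y \<in> cylinder (restr x n)" for y
  proof -
    have "y i \<in> X i" for i
    proof (cases "X i = UNIV")
      case False
      then have "y i = x i" using y n[of i] by (simp add: mem_cylinder restr_def)
      then show ?thesis using x by (simp add: PiE_iff)
    qed simp
    then have "y \<in> (\<Pi>\<^sub>E i\<in>UNIV. X i)" by (simp add: PiE_iff)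
    then show ?thesis using sub by (rule rev_subsetD)
  qed
  then show ?thesis by blast
qed

lemma ex_enum_open:
  assumes "open U"
  shows "\<exists>p. enum_open p = U"
proof -
  define p where "p n = (if cylinder (list_decode n) \<subseteq> U then Suc n else 0)" for n
  have "enum_open p = (\<Union>w \<in> {w. cylinder w \<subseteq> U}. cylinder w)"
  proof -
    have "(\<exists>i. p i = Suc (list_encode w)) \<longleftrightarrow> cylinder w \<subseteq> U" for w
    proof
      assume "\<exists>i. p i = Suc (list_encode w)"
      then show "cylinder w \<subseteq> U" by (auto simp: p_def split: if_splits)
    next
      assume "cylinder w \<subseteq> U"
      then have "p (list_encode w) = Suc (list_encode w)" by (simp add: p_def)
      then show "\<exists>i. p i = Suc (list_encode w)" by blast
    qed
    then show ?thesis by (simp add: enum_open_def)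
  qed
  also have "\<dots> = U"
  proof (intro equalityI subsetI)
    fix x assume "x \<in> U"
    then obtain n where "cylinder (restr x n) \<subseteq> U" using open_contains_cylinder[OF assms] by blast
    moreover have "x \<in> cylinder (restr x n)" by (simp add: cylinder_def restr_def)
    ultimately show "x \<in> (\<Union>w \<in> {w. cylinder w \<subseteq> U}. cylinder w)" by blast
  qed blast
  finally show ?thesis by blast
qed

lemma open_enum_open: "open (enum_open p)"
  unfolding enum_open_def by (intro open_UN ballI open_cylinder)

lemma ran_open_rep: "ran open_rep = {U. open U}"
  using ex_enum_open open_enum_open by (auto simp: ran_def open_rep_def)

lemma ran_clopen_rep: "ran clopen_rep = {W. open W \<and> closed W}"
proof (intro equalityI subsetI)
  fix W assume "W \<in> ran clopen_rep"
  then obtain r where "clopen_rep r = Some W" unfolding ran_def by blast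
  then have 1: "enum_open (bfst r) = W" and 2: "enum_open (bsnd r) = - W"
    by (simp_all add: clopen_rep_def split: if_split_asm)
  have "open W" "open (- W)"
    using open_enum_open[of "bfst r"] open_enum_open[of "bsnd r"] unfolding 1 2 .
  then show "W \<in> {W. open W \<and> closed W}" unfolding closed_def by blast
next
  fix W :: "baire set" assume "W \<in> {W. open W \<and> closed W}"
  then obtain p q where "enum_open p = W" "enum_open q = - W"
    using ex_enum_open[of W] ex_enum_open[of "- W"] by (auto simp: open_Compl)
  then have "clopen_rep (bpair p q) = Some W" by (simp add: clopen_rep_def)
  then show "W \<in> ran clopen_rep" unfolding ran_def by blast
qed


section \<open>Games\<close>

text \<open>
  Player 1 chooses the values of the run at even places and Player 2 those at odd places.  A
  strategy is applied to (the code of) the whole position reached so far; its values at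
  positions where the other player is to move are irrelevant.
\<close>

definition follows1 :: "baire \<Rightarrow> baire \<Rightarrow> bool" where
  "follows1 \<sigma> x \<longleftrightarrow> (\<forall>n. x (2 * n) = \<sigma> (list_encode (restr x (2 * n))))"

definition follows2 :: "baire \<Rightarrow> baire \<Rightarrow> bool" where
  "follows2 \<tau> x \<longleftrightarrow> (\<forall>n. x (2 * n + 1) = \<tau> (list_encode (restr x (2 * n + 1))))"

definition wins1 :: "baire set \<Rightarrow> baire \<Rightarrow> bool" where
  "wins1 W \<sigma> \<longleftrightarrow> (\<forall>x. follows1 \<sigma> x \<longrightarrow> x \<in> W)"

definition wins2 :: "baire set \<Rightarrow> baire \<Rightarrow> bool" where
  "wins2 W \<tau> \<longleftrightarrow> (\<forall>x. follows2 \<tau> x \<longrightarrow> x \<notin> W)"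


section \<open>The problems\<close>

definition UC_Baire :: "(nat list set, baire) problem" where
  "UC_Baire =
     \<lparr>in_rep = tree_rep, out_rep = baire_rep,
      inputs = {T. is_tree T \<and> (\<exists>x. tree_paths T = {x})},
      solutions = tree_paths\<rparr>"

definition FindWS_Sigma :: "(baire set, baire) problem" where
  "FindWS_Sigma =
     \<lparr>in_rep = open_rep, out_rep = baire_rep,
      inputs = {W. open W \<and> (\<nexists>\<tau>. wins2 W \<tau>)},
      solutions = (\<lambda>W. {\<sigma>. wins1 W \<sigma>})\<rparr>"

definition FindWS_Delta :: "(baire set, baire) problem" where
  "FindWS_Delta =
     \<lparr>in_rep = clopen_rep, out_rep = baire_rep,
      inputs = {W. open W \<and> closed W \<and> (\<nexists>\<tau>. wins2 W \<tau>)},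
      solutions = (\<lambda>W. {\<sigma>. wins1 W \<sigma>})\<rparr>"

definition Det_Delta :: "(baire set, baire \<times> baire) problem" where
  "Det_Delta =
     \<lparr>in_rep = clopen_rep, out_rep = prod_rep baire_rep baire_rep,
      inputs = {W. open W \<and> closed W},
      solutions = (\<lambda>W. {(\<sigma>, \<tau>). wins1 W \<sigma> \<or> wins2 W \<tau>})\<rparr>"

end

theory Submission imports Defs begin

text \<open>
  From clopen games to a single problem: a player who first chooses which side of \<open>W\<close> to play cannot
  lose, by strategy stealing, so \<open>Det_Delta\<close> reduces to \<open>FindWS_Delta\<close>.  The unique path of a tree is
  read off from a game in which the first player has to defend claims about its values against a
  competing path.

  Conversely, let the second player have no winning strategy in the game of an open set \<open>W\<close>.  Finite
  sequences \<open>s\<close> are regarded as initial segments of strategies of the second player, and \<open>s\<close> is secured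
  if it forces the run into some basic open set seen among the first \<open>length s\<close> ones enumerated into
  \<open>W\<close>, provided that the first player cooperates.  The tree of unsecured sequences is well-founded, as an
  infinite path is a winning strategy.  By bar recursion on this tree one assigns to every \<open>s\<close> a strategy
  of the first player that defeats all strategies extending \<open>s\<close>: let \<open>u\<close> be the position coded by
  \<open>length s\<close>, so that the extension \<open>s @ [k]\<close> answers \<open>k\<close> at \<open>u\<close>.  If for some \<open>k\<close> the strategy for
  \<open>s @ [k]\<close> avoids \<open>u\<close>, then it already works for \<open>s\<close>.  Otherwise all of them lead to \<open>u\<close>, and one
  continues from there with the strategy that belongs to the answer.  The whole assignment, together with
  the choices of \<open>k\<close>, is the only sequence satisfying a closed condition computable from \<open>W\<close>, hence the
  unique path of a tree.
\<close>

section \<open>Functions computable relative to an oracle\<close>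

text \<open>Programs act on numbers only. The class carries computability over to Booleans, pairs
  and lists through \<open>prod_encode\<close> and \<open>list_encode\<close>, so that one predicate
  serves for all types below.\<close>

class coded =
  fixes enc :: "'a \<Rightarrow> nat"

instantiation nat :: coded
begin
definition enc_nat_def [simp]: "enc (n :: nat) = n"
instance ..
end

instantiation bool :: coded
begin
definition enc_bool_def [simp]: "enc (b :: bool) = of_bool b"
instance ..
end

instantiation prod :: (coded, coded) coded
begin
definition enc_prod_def: "enc x = prod_encode (enc (fst x), enc (snd x))"
instance ..
end

instantiation list :: (coded) coded
begin
definition enc_list_def: "enc xs = list_encode (map enc xs)"
instance ..
end

lemma enc_Pair [simp]: "enc (a, b) = prod_encode (enc a, enc b)"
  by (simp add: enc_prod_def)

lemma enc_nat_list [simp]: "enc (xs :: nat list) = list_encode xs"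
  by (simp add: enc_list_def map_idI)

text \<open>One total program serves for all oracles, so the closure properties carry no side
  conditions on domains.\<close>

definition recursive :: "(baire \<Rightarrow> 'a::coded \<Rightarrow> 'b::coded) \<Rightarrow> bool" where
  "recursive f \<longleftrightarrow> (\<exists>c. \<forall>p x. eval c p [enc x] = Some (enc (f p x)))"

lemma recursiveI: "(\<And>p x. eval c p [enc x] = Some (enc (f p x))) \<Longrightarrow> recursive f"
  unfolding recursive_def by blast

lemma recursiveE:
  assumes "recursive f"
  obtains c where "\<And>p x. eval c p [enc x] = Some (enc (f p x))"
  using assms unfolding recursive_def by blast

section \<open>Programs for arithmetic and for the pairing function\<close>

definition add_prog :: orec where
  "add_prog = PrimRec (Proj 0) (Comp Succ [Proj 1])"

definition pred_prog :: orec where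
  "pred_prog = PrimRec Zero (Proj 0)"

text \<open>\<open>PrimRec\<close> recurses on its first argument, so the subtrahend comes first
  here.\<close>

definition flipped_sub_prog :: orec where
  "flipped_sub_prog = PrimRec (Proj 0) (Comp pred_prog [Proj 1])"

definition sub_prog :: orec where
  "sub_prog = Comp flipped_sub_prog [Proj 1, Proj 0]"

definition triangle_prog :: orec where
  "triangle_prog = PrimRec Zero (Comp add_prog [Comp Succ [Proj 0], Proj 1])"

definition pair_prog :: orec where
  "pair_prog = Comp add_prog [Comp triangle_prog [add_prog], Proj 0]"

text \<open>Inverts the pairing: \<open>prod_encode (a, b)\<close> is
  \<open>triangle (a + b) + a\<close>, so \<open>a + b\<close> is the least \<open>n\<close> with
  \<open>triangle (Suc n)\<close> above the code. \<open>Mu\<close> finds it as the first zero of a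
  truncated difference.\<close>

definition root_prog :: orec where
  "root_prog = Mu (Comp sub_prog [Comp Succ [Proj 1], Comp triangle_prog [Comp Succ [Proj 0]]])"

definition fst_prog :: orec where
  "fst_prog = Comp sub_prog [Proj 0, Comp triangle_prog [root_prog]]"

definition snd_prog :: orec where
  "snd_prog = Comp sub_prog [root_prog, fst_prog]"

lemma eval_add_prog [simp]: "eval add_prog p [m, n] = Some (m + n)"
  unfolding add_prog_def by (induction m) auto

lemma eval_pred_prog [simp]: "eval pred_prog p [n] = Some (n - 1)"
  unfolding pred_prog_def by (induction n) auto

lemma eval_flipped_sub_prog [simp]: "eval flipped_sub_prog p [m, n] = Some (n - m)"
  unfolding flipped_sub_prog_def by (induction m) auto

lemma eval_sub_prog [simp]: "eval sub_prog p [m, n] = Some (m - n)"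
  unfolding sub_prog_def by simp

lemma eval_triangle_prog [simp]: "eval triangle_prog p [n] = Some (triangle n)"
  unfolding triangle_prog_def by (induction n) auto

lemma eval_pair_prog [simp]: "eval pair_prog p [m, n] = Some (prod_encode (m, n))"
  unfolding pair_prog_def by (simp add: prod_encode_def)

lemma triangle_mono: "m \<le> n \<Longrightarrow> triangle m \<le> triangle n"
  by (induction n rule: dec_induct) auto

lemma triangle_root: "(LEAST n. triangle (a + b) + a < triangle (Suc n)) = a + b"
proof (rule Least_equality)
  fix n assume "triangle (a + b) + a < triangle (Suc n)"
  then have "triangle (a + b) < triangle (Suc n)" by simp
  then show "a + b \<le> n"
    using triangle_mono[of "Suc n" "a + b"] by linarith
qed simp

lemma eval_root_prog [simp]: "eval root_prog p [prod_encode (a, b)] = Some (a + b)"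
proof -
  have *: "Suc (prod_encode (a, b)) \<le> triangle (Suc n) \<longleftrightarrow>
      triangle (a + b) + a < triangle (Suc n)" for n
    by (auto simp: prod_encode_def)
  have "\<exists>n. triangle (a + b) + a < triangle (Suc n)"
    by (intro exI[of _ "a + b"]) simp
  then show ?thesis
    unfolding root_prog_def by (simp add: * triangle_root del: triangle_Suc diff_Suc_Suc)
qed

lemma eval_fst_prog [simp]: "eval fst_prog p [prod_encode (a, b)] = Some a"
  using eval_root_prog[of p a b] unfolding fst_prog_def by (simp add: prod_encode_def)

lemma eval_snd_prog [simp]: "eval snd_prog p [prod_encode (a, b)] = Some b"
  unfolding snd_prog_def by simp

lemma eval_PrimRec:
  assumes "eval f p ys = Some (enc b)"
    and "\<And>k v. eval g p (k # enc v # ys) = Some (enc (s k v))"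
  shows "eval (PrimRec f g) p (n # ys) = Some (enc (rec_nat b s n))"
  by (induction n) (use assms in auto)

section \<open>Closure under arithmetic, recursion, conditionals and bounded quantifiers\<close>

lemma recursive_id: "recursive (\<lambda>p x. x)"
  by (rule recursiveI[of "Proj 0"]) simp

lemma recursive_const: "recursive (\<lambda>p x. c)"
proof -
  have "\<exists>d. \<forall>p x. eval d p [x] = Some n" for n
  proof (induction n)
    case 0 show ?case by (intro exI[of _ Zero]) simp
  next
    case (Suc n)
    then obtain d where "\<forall>p x. eval d p [x] = Some n" by blast
    then show ?case by (intro exI[of _ "Comp Succ [d]"]) simp
  qed
  then show ?thesis unfolding recursive_def by blast
qed

lemma recursive_compose:
  assumes "recursive g" "recursive f"
  shows "recursive (\<lambda>p x. g p (f p x))"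
proof -
  from assms obtain c d where "\<And>p x. eval c p [enc x] = Some (enc (g p x))"
    "\<And>p x. eval d p [enc x] = Some (enc (f p x))" by (meson recursiveE)
  then show ?thesis by (intro recursiveI[of "Comp c [d]"]) simp
qed

lemma recursive_eval1:
  assumes "\<And>p y. eval c p [enc y] = Some (enc (g p y))" "recursive f"
  shows "recursive (\<lambda>p x. g p (f p x))"
  using assms recursive_compose recursiveI by blast

lemma recursive_eval2:
  assumes "\<And>p y z. eval c p [enc y, enc z] = Some (enc (h p y z))" "recursive f" "recursive g"
  shows "recursive (\<lambda>p x. h p (f p x) (g p x))"
proof -
  from assms obtain a b where "\<And>p x. eval a p [enc x] = Some (enc (f p x))"
    "\<And>p x. eval b p [enc x] = Some (enc (g p x))" by (meson recursiveE)
  then show ?thesis by (intro recursiveI[of "Comp c [a, b]"]) (simp add: assms(1))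
qed

lemma recursive_oracle: "recursive f \<Longrightarrow> recursive (\<lambda>p x. p (f p x))"
  by (rule recursive_eval1[of Oracle]) simp_all

lemma recursive_Suc: "recursive f \<Longrightarrow> recursive (\<lambda>p x. Suc (f p x))"
  by (rule recursive_eval1[of Succ]) simp_all

lemma recursive_Pair: "recursive f \<Longrightarrow> recursive g \<Longrightarrow> recursive (\<lambda>p x. (f p x, g p x))"
  by (rule recursive_eval2[of pair_prog]) simp_all

lemma recursive_fst: "recursive f \<Longrightarrow> recursive (\<lambda>p x. fst (f p x))"
  by (rule recursive_eval1[of fst_prog]) (simp_all add: enc_prod_def)

lemma recursive_snd: "recursive f \<Longrightarrow> recursive (\<lambda>p x. snd (f p x))"
  by (rule recursive_eval1[of snd_prog]) (simp_all add: enc_prod_def)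

lemma recursive_add: "recursive f \<Longrightarrow> recursive g \<Longrightarrow> recursive (\<lambda>p x. f p x + g p x :: nat)"
  by (rule recursive_eval2[of add_prog]) simp_all

lemma recursive_diff: "recursive f \<Longrightarrow> recursive g \<Longrightarrow> recursive (\<lambda>p x. f p x - g p x :: nat)"
  by (rule recursive_eval2[of sub_prog]) simp_all

lemma recursive_prod_encode:
  "recursive f \<Longrightarrow> recursive g \<Longrightarrow> recursive (\<lambda>p x. prod_encode (f p x, g p x))"
  by (rule recursive_eval2[of pair_prog]) simp_all

text \<open>The code of a pair is its \<open>prod_encode\<close>, so decoding leaves codes fixed and
  the identity program computes it; likewise for lists of numbers.\<close>

lemma recursive_prod_decode: "recursive f \<Longrightarrow> recursive (\<lambda>p x. prod_decode (f p x))"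
  by (rule recursive_eval1[of "Proj 0"]) (simp_all add: enc_prod_def)

lemma recursive_list_encode: "recursive f \<Longrightarrow> recursive (\<lambda>p x. list_encode (f p x))"
  by (rule recursive_eval1[of "Proj 0"]) simp_all

lemma recursive_list_decode: "recursive f \<Longrightarrow> recursive (\<lambda>p x. list_decode (f p x))"
  by (rule recursive_eval1[of "Proj 0"]) simp_all

text \<open>The step function takes its arguments as one nested pair, written with projections, so
  that the closure rules apply to its body syntactically.\<close>

lemma recursive_rec_nat:
  assumes "recursive b" "recursive n"
    and "recursive (\<lambda>p y. s p (fst y) (fst (snd y)) (snd (snd y)))"
  shows "recursive (\<lambda>p x. rec_nat (b p x) (\<lambda>k v. s p k v x) (n p x))"
proof -
  from assms obtain cb cn cs where
    b: "\<And>p x. eval cb p [enc x] = Some (enc (b p x))" and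
    n: "\<And>p x. eval cn p [enc x] = Some (n p x)" and
    s: "\<And>p y. eval cs p [enc y] = Some (enc (s p (fst y) (fst (snd y)) (snd (snd y))))"
    unfolding recursive_def enc_nat_def by metis
  define c where "c = Comp (PrimRec cb (Comp cs [Comp pair_prog [Proj 0, Comp pair_prog [Proj 1, Proj 2]]]))
    [cn, Proj 0]"
  have "eval (PrimRec cb (Comp cs [Comp pair_prog [Proj 0, Comp pair_prog [Proj 1, Proj 2]]])) p
      [n p x, enc x] = Some (enc (rec_nat (b p x) (\<lambda>k v. s p k v x) (n p x)))" for p x
    using s[of p "(k, v, x)" for k v] by (intro eval_PrimRec) (simp_all add: b)
  then show ?thesis
    by (intro recursiveI[of c]) (simp add: c_def n)
qed

lemma recursive_if:
  assumes "recursive b" "recursive f" "recursive g"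
  shows "recursive (\<lambda>p x. if b p x then f p x else g p x)"
proof -
  from assms obtain cb cf cg where
    "\<And>p x. eval cb p [enc x] = Some (of_bool (b p x))"
    "\<And>p x. eval cf p [enc x] = Some (enc (f p x))"
    "\<And>p x. eval cg p [enc x] = Some (enc (g p x))"
    unfolding recursive_def enc_bool_def by metis
  \<comment> \<open>Recursion on the truth value: at 0 the base selects the second branch, at 1 the
    step selects the first one from the argument list.\<close>
  then show ?thesis
    by (intro recursiveI[of "Comp (PrimRec (Proj 1) (Proj 2)) [cb, cf, cg]"]) simp
qed

lemma recursive_not: "recursive P \<Longrightarrow> recursive (\<lambda>p x. \<not> P p x)"
  by (rule back_subst[of recursive, OF recursive_if[of P "\<lambda>p x. False" "\<lambda>p x. True"]])
    (auto simp: recursive_const fun_eq_iff)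

lemma recursive_conj: "recursive P \<Longrightarrow> recursive Q \<Longrightarrow> recursive (\<lambda>p x. P p x \<and> Q p x)"
  by (rule back_subst[of recursive, OF recursive_if[of P Q "\<lambda>p x. False"]])
    (auto simp: recursive_const fun_eq_iff)

lemma recursive_disj: "recursive P \<Longrightarrow> recursive Q \<Longrightarrow> recursive (\<lambda>p x. P p x \<or> Q p x)"
  by (rule back_subst[of recursive, OF recursive_if[of P "\<lambda>p x. True" Q]])
    (auto simp: recursive_const fun_eq_iff)

lemma recursive_imp: "recursive P \<Longrightarrow> recursive Q \<Longrightarrow> recursive (\<lambda>p x. P p x \<longrightarrow> Q p x)"
  by (rule back_subst[of recursive, OF recursive_if[of P Q "\<lambda>p x. True"]])
    (auto simp: recursive_const fun_eq_iff)

lemma recursive_eq_0: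
  assumes "recursive f"
  shows "recursive (\<lambda>p x. f p x = (0 :: nat))"
proof -
  have "recursive (\<lambda>p x. rec_nat True (\<lambda>k v. False) (f p x))"
    by (intro recursive_rec_nat assms recursive_const)
  moreover have "rec_nat True (\<lambda>k v. False) n \<longleftrightarrow> n = 0" for n by (cases n) auto
  ultimately show ?thesis by simp
qed

lemma recursive_le:
  "recursive f \<Longrightarrow> recursive g \<Longrightarrow> recursive (\<lambda>p x. f p x \<le> (g p x :: nat))"
  using recursive_eq_0[OF recursive_diff[of f g]] by simp

lemma recursive_less:
  "recursive f \<Longrightarrow> recursive g \<Longrightarrow> recursive (\<lambda>p x. f p x < (g p x :: nat))"
  using recursive_le[OF recursive_Suc] by (simp add: Suc_le_eq)

lemma recursive_eq:
  "recursive f \<Longrightarrow> recursive g \<Longrightarrow> recursive (\<lambda>p x. f p x = (g p x :: nat))"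
  using recursive_conj[OF recursive_le[of f g] recursive_le[of g f]] by (simp add: eq_iff)

lemma recursive_eq_list:
  "recursive f \<Longrightarrow> recursive g \<Longrightarrow> recursive (\<lambda>p x. f p x = (g p x :: nat list))"
  using recursive_eq[OF recursive_list_encode recursive_list_encode, of f g]
  by (simp add: list_encode_eq)

lemma recursive_even:
  assumes "recursive f"
  shows "recursive (\<lambda>p x. even (f p x :: nat))"
proof -
  have "recursive (\<lambda>p x. rec_nat True (\<lambda>k v. \<not> v) (f p x))"
    by (intro recursive_rec_nat assms recursive_const recursive_not recursive_fst recursive_snd recursive_id)
  moreover have "rec_nat True (\<lambda>k v. \<not> v) n \<longleftrightarrow> even n" for n by (induction n) auto
  ultimately show ?thesis by simp
qed

lemma recursive_div2:
  assumes "recursive f"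
  shows "recursive (\<lambda>p x. f p x div 2 :: nat)"
proof -
  have "recursive (\<lambda>p x. rec_nat 0 (\<lambda>k v. if even k then v else Suc v) (f p x))"
    by (intro recursive_rec_nat assms recursive_const recursive_if recursive_even recursive_Suc
        recursive_fst recursive_snd recursive_id)
  moreover have "rec_nat 0 (\<lambda>k v. if even k then v else Suc v) n = n div 2" for n
    by (induction n) auto
  ultimately show ?thesis by simp
qed

lemma recursive_double: "recursive f \<Longrightarrow> recursive (\<lambda>p x. 2 * f p x :: nat)"
  using recursive_add[of f f] by (simp add: mult_2)

lemma recursive_ex_less:
  fixes P :: "baire \<Rightarrow> nat \<Rightarrow> 'a::coded \<Rightarrow> bool"
  assumes "recursive n" "recursive (\<lambda>p y. P p (fst y) (snd y))"
  shows "recursive (\<lambda>p x. \<exists>i<n p x. P p i x)"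
proof -
  have "recursive (\<lambda>p (y :: nat \<times> bool \<times> 'a). P p (fst y) (snd (snd y)))"
    using recursive_compose[OF assms(2), of "\<lambda>p y. (fst y, snd (snd y))"]
    by (simp add: recursive_Pair recursive_fst recursive_snd recursive_id)
  then have "recursive (\<lambda>p x. rec_nat False (\<lambda>i v. v \<or> P p i x) (n p x))"
    by (intro recursive_rec_nat assms(1) recursive_const recursive_disj recursive_fst recursive_snd
        recursive_id)
  moreover have "rec_nat False (\<lambda>i v. v \<or> Q i) m \<longleftrightarrow> (\<exists>i<m. Q i)" for m Q
    by (induction m) (auto simp: less_Suc_eq)
  ultimately show ?thesis by simp
qed

lemma recursive_all_less:
  fixes P :: "baire \<Rightarrow> nat \<Rightarrow> 'a::coded \<Rightarrow> bool"
  assumes "recursive n" "recursive (\<lambda>p y. P p (fst y) (snd y))"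
  shows "recursive (\<lambda>p x. \<forall>i<n p x. P p i x)"
  using recursive_not[OF recursive_ex_less[OF assms(1) recursive_not[OF assms(2)]]] by simp

section \<open>Recursive operations on lists, and bounded search\<close>

lemma recursive_Cons:
  "recursive f \<Longrightarrow> recursive g \<Longrightarrow> recursive (\<lambda>p x. f p x # (g p x :: nat list))"
  by (rule recursive_eval2[of "Comp Succ [pair_prog]"]) simp_all

lemma prod_decode_0 [simp]: "prod_decode 0 = (0, 0)"
  using prod_encode_inverse[of "(0, 0)"] by (simp add: prod_encode_def)

lemma recursive_tl:
  assumes "recursive f"
  shows "recursive (\<lambda>p x. tl (f p x :: nat list))"
proof -
  \<comment> \<open>This also covers the empty list: its code is 0, and 0 decodes to
    \<open>(0, 0)\<close>, whose second component again codes \<open>[]\<close>.\<close>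
  have "tl xs = list_decode (snd (prod_decode (list_encode xs - 1)))" for xs
    by (cases xs) auto
  then show ?thesis
    by (simp only:) (intro recursive_list_decode recursive_snd recursive_prod_decode recursive_diff
        recursive_list_encode recursive_const assms)
qed

text \<open>A fixed default lets one program serve for all lists, the empty one included.\<close>

definition hd0 :: "nat list \<Rightarrow> nat" where
  "hd0 xs = (case xs of [] \<Rightarrow> 0 | x # _ \<Rightarrow> x)"

lemma recursive_hd0:
  assumes "recursive f"
  shows "recursive (\<lambda>p x. hd0 (f p x))"
proof -
  have "hd0 xs = fst (prod_decode (list_encode xs - 1))" for xs
    by (cases xs) (auto simp: hd0_def)
  then show ?thesis
    by (simp only:) (intro recursive_fst recursive_prod_decode recursive_diff
        recursive_list_encode recursive_const assms)
qed

lemma recursive_drop: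
  assumes "recursive n" "recursive f"
  shows "recursive (\<lambda>p x. drop (n p x) (f p x :: nat list))"
proof -
  have "recursive (\<lambda>p x. rec_nat (f p x) (\<lambda>k v. tl v) (n p x))"
    by (intro recursive_rec_nat assms recursive_tl recursive_fst recursive_snd recursive_id)
  moreover have "rec_nat xs (\<lambda>k v. tl v) m = drop m xs" for m and xs :: "nat list"
    by (induction m) (auto simp: drop_Suc tl_drop)
  ultimately show ?thesis by simp
qed

definition nth0 :: "nat list \<Rightarrow> nat \<Rightarrow> nat" where
  "nth0 xs i = (if i < length xs then xs ! i else 0)"

lemma recursive_nth0:
  assumes "recursive f" "recursive n"
  shows "recursive (\<lambda>p x. nth0 (f p x) (n p x))"
proof -
  have "nth0 xs i = hd0 (drop i xs)" for xs i
    by (auto simp: nth0_def hd0_def hd_drop_conv_nth[symmetric] split: list.split)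
  then show ?thesis
    by (simp only:) (intro recursive_hd0 recursive_drop assms)
qed

lemma length_le_list_encode: "length xs \<le> list_encode xs"
proof (induction xs)
  case (Cons x xs)
  then show ?case using le_prod_encode_2[of "list_encode xs" x] by simp
qed simp

text \<open>The code of a list bounds its length, hence the number of steps of the iteration below.\<close>

lemma recursive_foldl:
  assumes "recursive b" "recursive l"
    and "recursive (\<lambda>p y. s p (fst y) (fst (snd y)) (snd (snd y)))"
  shows "recursive (\<lambda>p x. foldl (\<lambda>v h. s p v h x) (b p x) (l p x :: nat list))"
proof -
  define step where "step p a x =
    (if list_encode (fst a) = 0 then a else (tl (fst a), s p (snd a) (hd0 (fst a)) x))" for p a x
  have "recursive (\<lambda>p (y :: nat \<times> (nat list \<times> 'b) \<times> 'a).
      s p (snd (fst (snd y))) (hd0 (fst (fst (snd y)))) (snd (snd y)))"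
    using recursive_compose[OF assms(3),
        of "\<lambda>p y. (snd (fst (snd y)), hd0 (fst (fst (snd y))), snd (snd y))"]
    by (simp add: recursive_Pair recursive_fst recursive_snd recursive_id recursive_hd0)
  then have "recursive (\<lambda>p x. snd (rec_nat (l p x, b p x) (\<lambda>k a. step p a x) (list_encode (l p x))))"
    unfolding step_def
    by (intro recursive_rec_nat assms recursive_const recursive_if recursive_eq_0 recursive_Pair
        recursive_fst recursive_snd recursive_id recursive_tl recursive_list_encode)
  moreover have "rec_nat (xs, c) (\<lambda>k a. step p a x) n =
      (drop n xs, foldl (\<lambda>v h. s p v h x) c (take n xs))" for p x xs c n
  proof (induction n)
    case (Suc n)
    show ?case
    proof (cases "n < length xs")
      case True
      then have "drop n xs = xs ! n # drop (Suc n) xs" by (simp add: Cons_nth_drop_Suc)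
      then show ?thesis using Suc True by (simp add: step_def hd0_def take_Suc_conv_app_nth)
    next
      case False
      then show ?thesis using Suc by (simp add: step_def)
    qed
  qed simp
  ultimately show ?thesis using length_le_list_encode by simp
qed

lemma recursive_length:
  assumes "recursive f"
  shows "recursive (\<lambda>p x. length (f p x :: nat list))"
proof -
  have "recursive (\<lambda>p x. foldl (\<lambda>v h. Suc v) 0 (f p x))"
    by (intro recursive_foldl assms recursive_const recursive_Suc recursive_fst recursive_id)
  moreover have "foldl (\<lambda>v h. Suc v) n xs = n + length xs" for n and xs :: "nat list"
    by (induction xs arbitrary: n) auto
  ultimately show ?thesis by simp
qed

lemma recursive_rev:
  assumes "recursive f"
  shows "recursive (\<lambda>p x. rev (f p x :: nat list))"
proof -
  have "recursive (\<lambda>p x. foldl (\<lambda>v h. h # v) [] (f p x))"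
    by (intro recursive_foldl assms recursive_const recursive_Cons recursive_fst recursive_snd recursive_id)
  then show ?thesis by (simp add: foldl_conv_fold flip: rev_conv_fold)
qed

lemma recursive_append:
  assumes "recursive f" "recursive g"
  shows "recursive (\<lambda>p x. f p x @ (g p x :: nat list))"
proof -
  have "recursive (\<lambda>p x. foldl (\<lambda>v h. h # v) (g p x) (rev (f p x)))"
    by (intro recursive_foldl assms recursive_const recursive_Cons recursive_rev recursive_fst
        recursive_snd recursive_id)
  moreover have "foldl (\<lambda>v h. h # v) ys (rev xs) = xs @ ys" for xs ys :: "nat list"
    by (induction xs) auto
  ultimately show ?thesis by simp
qed

lemma recursive_map_upt:
  assumes "recursive n" "recursive (\<lambda>p y. f p (fst y) (snd y))"
  shows "recursive (\<lambda>p x. map (\<lambda>i. f p i x :: nat) [0..<n p x])"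
proof -
  have "recursive (\<lambda>p (y :: nat \<times> nat list \<times> 'a). f p (fst y) (snd (snd y)))"
    using recursive_compose[OF assms(2), of "\<lambda>p y. (fst y, snd (snd y))"]
    by (simp add: recursive_Pair recursive_fst recursive_snd recursive_id)
  then have "recursive (\<lambda>p x. rec_nat [] (\<lambda>i v. v @ [f p i x]) (n p x))"
    by (intro recursive_rec_nat assms(1) recursive_const recursive_append recursive_Cons
        recursive_fst recursive_snd recursive_id)
  moreover have "rec_nat [] (\<lambda>i v. v @ [h i]) m = map h [0..<m]" for m and h :: "nat \<Rightarrow> nat"
    by (induction m) auto
  ultimately show ?thesis by simp
qed

lemma recursive_take:
  assumes "recursive n" "recursive f"
  shows "recursive (\<lambda>p x. take (n p x) (f p x :: nat list))"
proof -
  have "take m xs = rev (drop (length xs - m) (rev xs))" for m and xs :: "nat list"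
    by (cases "m \<le> length xs") (simp_all add: rev_drop)
  then show ?thesis
    by (simp only:) (intro recursive_rev recursive_drop recursive_diff recursive_length assms)
qed

text \<open>Bounded search as a primitive recursion: the candidate \<open>v\<close> is frozen once
  \<open>P v\<close> holds and otherwise moves on to \<open>Suc k\<close>.\<close>

definition search :: "(nat \<Rightarrow> bool) \<Rightarrow> nat \<Rightarrow> nat" where
  "search P n = rec_nat 0 (\<lambda>k v. if P v then v else Suc k) n"

lemma search:
  assumes "P i" "i < n"
  shows "P (search P n) \<and> search P n < n"
proof -
  have "search P n = n \<and> (\<forall>i<n. \<not> P i) \<or> search P n < n \<and> P (search P n)" for n
    unfolding search_def by (induction n) (auto simp: less_Suc_eq)
  then show ?thesis using assms by blast
qed

lemma recursive_search:
  assumes "recursive n" "recursive (\<lambda>p y. P p (fst y) (snd y))"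
  shows "recursive (\<lambda>p x. search (\<lambda>i. P p i x) (n p x))"
proof -
  have "recursive (\<lambda>p (y :: nat \<times> nat \<times> 'a). P p (fst (snd y)) (snd (snd y)))"
    using recursive_compose[OF assms(2), of "\<lambda>p y. (fst (snd y), snd (snd y))"]
    by (simp add: recursive_Pair recursive_fst recursive_snd recursive_id)
  then show ?thesis unfolding search_def
    by (intro recursive_rec_nat assms(1) recursive_const recursive_if recursive_Suc recursive_fst
        recursive_snd recursive_id)
qed

lemmas recursive_intros = recursive_id recursive_const recursive_oracle recursive_Suc
  recursive_Pair recursive_fst recursive_snd recursive_add recursive_diff recursive_prod_encode
  recursive_prod_decode recursive_list_encode recursive_list_decode recursive_rec_nat
  recursive_if recursive_not recursive_conj recursive_disj recursive_imp
  recursive_le recursive_less recursive_eq recursive_eq_list recursive_even recursive_div2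
  recursive_double recursive_ex_less recursive_all_less recursive_Cons recursive_tl recursive_hd0
  recursive_drop recursive_nth0 recursive_length recursive_append
  recursive_map_upt recursive_take recursive_search

section \<open>Computable partial functionals and their composition\<close>

lemma computableI: "recursive F \<Longrightarrow> computable (\<lambda>p. Some (F p))"
  unfolding recursive_def computable_def by auto

text \<open>Applying \<^const>\<open>Succ\<close> and taking the predecessor restricts a program to argument lists
  of length one, like \<^const>\<open>Oracle\<close>.\<close>

primrec subst_oracle :: "orec \<Rightarrow> orec \<Rightarrow> orec" where
  "subst_oracle c Zero = Zero"
| "subst_oracle c Succ = Succ"
| "subst_oracle c (Proj i) = Proj i"
| "subst_oracle c Oracle = Comp c [Comp pred_prog [Succ]]"
| "subst_oracle c (Comp f gs) = Comp (subst_oracle c f) (map (subst_oracle c) gs)"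
| "subst_oracle c (PrimRec f g) = PrimRec (subst_oracle c f) (subst_oracle c g)"
| "subst_oracle c (Mu f) = Mu (subst_oracle c f)"

text \<open>Stated for arbitrary argument lists because the induction descends into subprograms that
  are applied to other lists.\<close>

lemma eval_subst_oracle:
  assumes "\<And>n. eval c p [n] = Some (q n)"
  shows "eval (subst_oracle c d) p xs = eval d q xs"
proof (induction d arbitrary: xs)
  case Oracle
  then show ?case by (auto simp: assms split: list.split)
next
  case (Comp f gs)
  then have "map (\<lambda>g. eval g p xs) (map (subst_oracle c) gs) = map (\<lambda>g. eval g q xs) gs" by simp
  moreover have "eval (subst_oracle c f) p = eval f q" using Comp by (intro ext) simp
  ultimately show ?case by (simp only: subst_oracle.simps eval.simps)
qed (auto split: list.split)

lemma computable_compose: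
  assumes "computable F" "computable G"
  shows "computable (\<lambda>p. Option.bind (F p) G)"
proof -
  from assms obtain c d where c: "\<And>p q n. F p = Some q \<Longrightarrow> eval c p [n] = Some (q n)"
    and d: "\<And>p q n. G p = Some q \<Longrightarrow> eval d p [n] = Some (q n)"
    unfolding computable_def by metis
  have "eval (subst_oracle c d) p [n] = Some (r n)" if "F p = Some q" "G q = Some r" for p q r n
    using eval_subst_oracle[OF c[OF that(1)]] d[OF that(2)] by simp
  then show ?thesis unfolding computable_def
    by (intro exI[of _ "subst_oracle c d"]) (auto simp: bind_eq_Some_conv)
qed

lemma computable_bpair:
  assumes "computable F" "computable G"
  shows "computable (\<lambda>p. Option.bind (F p) (\<lambda>q. Option.bind (G p) (\<lambda>r. Some (bpair q r))))"
proof -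
  from assms obtain c d where c: "\<And>p q n. F p = Some q \<Longrightarrow> eval c p [n] = Some (q n)"
    and d: "\<And>p q n. G p = Some q \<Longrightarrow> eval d p [n] = Some (q n)"
    unfolding computable_def by metis
  obtain h where h: "\<And>p n. eval h p [n] = Some (n div 2)"
    using recursive_div2[OF recursive_id] unfolding recursive_def by auto
  obtain e where e: "\<And>p n. eval e p [n] = Some (of_bool (even n))"
    using recursive_even[OF recursive_id] unfolding recursive_def by auto
  \<comment> \<open>The conditional evaluates both branches; this is safe because \<open>F\<close>
    and \<open>G\<close> are both defined at \<open>p\<close>.\<close>
  have "eval (Comp (PrimRec (Proj 1) (Proj 2)) [e, Comp c [h], Comp d [h]]) p [n] =
      Some (bpair q r n)" if "F p = Some q" "G p = Some r" for p q r n
    by (simp add: c[OF that(1)] d[OF that(2)] h e bpair_def)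
  then show ?thesis unfolding computable_def
    by (intro exI[of _ "Comp (PrimRec (Proj 1) (Proj 2)) [e, Comp c [h], Comp d [h]]"])
      (auto simp: bind_eq_Some_conv)
qed

lemma computable_bfst: "computable (\<lambda>p. Some (bfst p))"
  unfolding bfst_def by (intro computableI recursive_intros)

lemma computable_bsnd: "computable (\<lambda>p. Some (bsnd p))"
  unfolding bsnd_def by (intro computableI recursive_intros)

section \<open>Weihrauch reductions and games\<close>

lemma weihrauch_le_trans:
  assumes "f \<le>\<^sub>W g" "g \<le>\<^sub>W h"
  shows "f \<le>\<^sub>W h"
proof -
  from assms(1) obtain H1 K1 where 1: "computable H1" "computable K1"
    and r1: "\<And>G. realizes G g \<Longrightarrow>
      realizes (\<lambda>p. Option.bind (H1 p) (\<lambda>q. Option.bind (G q) (\<lambda>r. K1 (bpair p r)))) f"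
    unfolding weihrauch_le_def by blast
  from assms(2) obtain H2 K2 where 2: "computable H2" "computable K2"
    and r2: "\<And>G. realizes G h \<Longrightarrow>
      realizes (\<lambda>p. Option.bind (H2 p) (\<lambda>q. Option.bind (G q) (\<lambda>r. K2 (bpair p r)))) g"
    unfolding weihrauch_le_def by blast
  \<comment> \<open>For \<open>s = bpair p r\<close> the instance \<open>H1 p\<close> is recomputed
    from \<open>p\<close>; \<open>K2\<close> turns it and \<open>r\<close> into a solution of
    \<open>g\<close>, and \<open>K1\<close> turns that and \<open>p\<close> into one of
    \<open>f\<close>.\<close>
  define K where "K s = Option.bind
      (Option.bind (Some (bfst s)) (\<lambda>p. Option.bind
        (Option.bind
          (Option.bind (Option.bind (Some (bfst s)) H1)
            (\<lambda>q. Option.bind (Some (bsnd s)) (\<lambda>r. Some (bpair q r)))) K2)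
        (\<lambda>r. Some (bpair p r)))) K1" for s
  have "computable K" unfolding K_def
    by (intro computable_compose computable_bpair computable_bfst computable_bsnd 1 2)
  moreover have "computable (\<lambda>p. Option.bind (H1 p) H2)"
    by (intro computable_compose 1 2)
  moreover have "realizes (\<lambda>p. Option.bind (Option.bind (H1 p) H2)
      (\<lambda>q. Option.bind (G q) (\<lambda>r. K (bpair p r)))) f" if "realizes G h" for G
  proof -
    have "(\<lambda>p. Option.bind (Option.bind (H1 p) H2) (\<lambda>q. Option.bind (G q) (\<lambda>r. K (bpair p r)))) =
        (\<lambda>p. Option.bind (H1 p) (\<lambda>q. Option.bind
          (Option.bind (H2 q) (\<lambda>q'. Option.bind (G q') (\<lambda>r. K2 (bpair q r)))) (\<lambda>r. K1 (bpair p r))))"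
      by (auto simp: K_def fun_eq_iff split: bind_splits)
    then show ?thesis using r1[OF r2[OF that]] by simp
  qed
  ultimately show ?thesis unfolding weihrauch_le_def by blast
qed

text \<open>Realizers can be eliminated for total functionals: all that matters about
  \<open>G\<close> is that \<open>G (H p)\<close> names some solution.\<close>

lemma weihrauch_leI:
  assumes "recursive H" "recursive K"
    and "\<And>p x. x \<in> inputs f \<Longrightarrow> in_rep f p = Some x \<Longrightarrow>
      \<exists>y\<in>inputs g. in_rep g (H p) = Some y \<and>
        (\<forall>r z. out_rep g r = Some z \<longrightarrow> z \<in> solutions g y \<longrightarrow>
          (\<exists>w. out_rep f (K (bpair p r)) = Some w \<and> w \<in> solutions f x))"
  shows "f \<le>\<^sub>W g"
proof -
  have "realizes (\<lambda>p. Option.bind (Some (H p)) (\<lambda>q. Option.bind (G q) (\<lambda>r. Some (K (bpair p r))))) f"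
    if G: "realizes G g" for G
    unfolding realizes_def
  proof (intro ballI allI impI)
    fix x p assume "x \<in> inputs f" "in_rep f p = Some x"
    from assms(3)[OF this] obtain y where y: "y \<in> inputs g" "in_rep g (H p) = Some y"
      and *: "\<And>r z. out_rep g r = Some z \<Longrightarrow> z \<in> solutions g y \<Longrightarrow>
          \<exists>w. out_rep f (K (bpair p r)) = Some w \<and> w \<in> solutions f x" by blast
    from G y obtain r z where "G (H p) = Some r" "out_rep g r = Some z" "z \<in> solutions g y"
      unfolding realizes_def by blast
    with *[of r z] show "\<exists>q y. Option.bind (Some (H p))
        (\<lambda>q. Option.bind (G q) (\<lambda>r. Some (K (bpair p r)))) = Some q \<and>
        out_rep f q = Some y \<and> y \<in> solutions f x" by auto
  qed
  then show ?thesis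
    unfolding weihrauch_le_def using assms(1,2)[THEN computableI] by blast
qed

section \<open>Runs, residual strategies and names of open sets\<close>

lemma length_restr [simp]: "length (restr x n) = n"
  by (simp add: restr_def)

lemma nth_restr [simp]: "i < n \<Longrightarrow> restr x n ! i = x i"
  by (simp add: restr_def)

lemma restr_0 [simp]: "restr x 0 = []"
  by (simp add: restr_def)

lemma restr_Suc: "restr x (Suc n) = restr x n @ [x n]"
  by (simp add: restr_def)

lemma take_restr [simp]: "take k (restr x n) = restr x (min k n)"
  by (simp add: restr_def take_map min_def)

lemma restr_case_nat [simp]: "restr (case_nat a x) (Suc n) = a # restr x n"
  by (induction n) (simp_all add: restr_Suc)

lemma case_nat_cases:
  fixes x :: baire
  obtains a y where "x = case_nat a y"
  by (rule that[of "x 0" "\<lambda>n. x (Suc n)"]) (auto split: nat.split)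

text \<open>The residual strategy once \<open>a\<close> has been played. Dropping the first move
  shifts parities, so residuals of strategies of one player are strategies of the other.\<close>

definition after :: "nat \<Rightarrow> baire \<Rightarrow> baire" where
  "after a \<sigma> = (\<lambda>q. \<sigma> (list_encode (a # list_decode q)))"

lemma follows2_case_nat: "follows2 \<tau> (case_nat a x) \<longleftrightarrow> follows1 (after a \<tau>) x"
  by (simp add: follows1_def follows2_def after_def)

lemma follows1_case_nat:
  "follows1 \<sigma> (case_nat a x) \<longleftrightarrow> a = \<sigma> (list_encode []) \<and> follows2 (after a \<sigma>) x"
proof -
  have "(\<forall>n. P n) \<longleftrightarrow> P 0 \<and> (\<forall>n. P (Suc n))" for P :: "nat \<Rightarrow> bool"
    by (metis not0_implies_Suc)
  from this[of "\<lambda>n. case_nat a x (2 * n) = \<sigma> (list_encode (restr (case_nat a x) (2 * n)))"]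
  show ?thesis by (simp add: follows1_def follows2_def after_def)
qed

primrec play :: "baire \<Rightarrow> baire \<Rightarrow> nat \<Rightarrow> nat list" where
  "play \<sigma> \<tau> 0 = []"
| "play \<sigma> \<tau> (Suc n) = play \<sigma> \<tau> n @ [(if even n then \<sigma> else \<tau>) (list_encode (play \<sigma> \<tau> n))]"

lemma follows_both:
  obtains x where "follows1 \<sigma> x" "follows2 \<tau> x"
proof -
  define x where "x n = (if even n then \<sigma> else \<tau>) (list_encode (play \<sigma> \<tau> n))" for n
  have "restr x n = play \<sigma> \<tau> n" for n
    by (induction n) (simp_all add: restr_Suc x_def)
  then have "follows1 \<sigma> x" "follows2 \<tau> x"
    by (simp_all add: follows1_def follows2_def x_def)
  then show ?thesis by (rule that)
qed

lemma not_wins_both: "wins1 W \<sigma> \<Longrightarrow> \<not> wins2 W \<tau>"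
  unfolding wins1_def wins2_def by (metis follows_both)

lemma mem_enum_open:
  "x \<in> enum_open p \<longleftrightarrow> (\<exists>i w. p i = Suc (list_encode w) \<and> x \<in> cylinder w)"
  by (auto simp: enum_open_def)

lemma case_nat_in_cylinder [simp]: "case_nat a x \<in> cylinder (b # w) \<longleftrightarrow> a = b \<and> x \<in> cylinder w"
  by (auto simp: cylinder_def)

lemma clopen_rep_eq_Some:
  "clopen_rep r = Some W \<longleftrightarrow> enum_open (bfst r) = W \<and> enum_open (bsnd r) = - W"
  by (auto simp: clopen_rep_def)

lemma clopen_rep_clopen: "clopen_rep r = Some W \<Longrightarrow> open W \<and> closed W"
  using ran_clopen_rep by (auto simp: ran_def)

section \<open>Reductions among the game problems\<close>

lemma FindWS_Delta_le_Det_Delta: "FindWS_Delta \<le>\<^sub>W Det_Delta"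
proof (rule weihrauch_leI)
  show "recursive (\<lambda>p n. p n)" by (intro recursive_intros)
  \<comment> \<open>Of the two strategies the first must win, as the second player has no winning
    strategy.\<close>
  show "recursive (\<lambda>s. bfst (bsnd s))" unfolding bfst_def bsnd_def by (intro recursive_intros)
qed (auto simp: FindWS_Delta_def Det_Delta_def prod_rep_def baire_rep_def)

lemma FindWS_Delta_le_FindWS_Sigma: "FindWS_Delta \<le>\<^sub>W FindWS_Sigma"
proof (rule weihrauch_leI)
  show "recursive (\<lambda>p. bfst p)" unfolding bfst_def by (intro recursive_intros)
  show "recursive (\<lambda>s. bsnd s)" unfolding bsnd_def by (intro recursive_intros)
qed (auto simp: FindWS_Delta_def FindWS_Sigma_def open_rep_def baire_rep_def clopen_rep_eq_Some)

text \<open>With the move 0 the first player chooses to go first in \<open>A\<close>; a dummy move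
  of the opponent restores the turn. A positive move makes the opponent go first, with
  \<open>B\<close> as the set to be reached.\<close>

definition side_game :: "baire set \<Rightarrow> baire set \<Rightarrow> baire set" where
  "side_game A B = {x. if x 0 = 0 then (\<lambda>n. x (n + 2)) \<in> A else (\<lambda>n. x (n + 1)) \<in> B}"

lemma side_game_0 [simp]: "case_nat 0 (case_nat d x) \<in> side_game A B \<longleftrightarrow> x \<in> A"
  by (simp add: side_game_def)

lemma side_game_Suc [simp]: "case_nat (Suc a) x \<in> side_game A B \<longleftrightarrow> x \<in> B"
  by (simp add: side_game_def)

lemma Compl_side_game: "- side_game A B = side_game (- A) (- B)"
  by (auto simp: side_game_def)

text \<open>The index codes a triple \<open>(j, d, e)\<close>: \<open>j\<close> is the stage of the
  given enumeration, \<open>e\<close> selects the side, and \<open>d\<close> runs through the dummy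
  moves or, as \<open>Suc d\<close>, through the positive first moves.\<close>

definition side_enum :: "baire \<Rightarrow> baire \<Rightarrow> baire" where
  "side_enum p q i =
    (if snd (prod_decode (snd (prod_decode i))) = 0
     then if p (fst (prod_decode i)) = 0 then 0
       else Suc (list_encode (0 # fst (prod_decode (snd (prod_decode i))) #
         list_decode (p (fst (prod_decode i)) - 1)))
     else if q (fst (prod_decode i)) = 0 then 0
       else Suc (list_encode (Suc (fst (prod_decode (snd (prod_decode i)))) #
         list_decode (q (fst (prod_decode i)) - 1))))"

lemma enum_open_side_enum: "enum_open (side_enum p q) = side_game (enum_open p) (enum_open q)"
proof (intro equalityI subsetI)
  fix x assume "x \<in> enum_open (side_enum p q)"
  then obtain i w where i: "side_enum p q i = Suc (list_encode w)" "x \<in> cylinder w"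
    by (auto simp: mem_enum_open)
  obtain j d e where [simp]: "i = prod_encode (j, prod_encode (d, e))"
    by (metis prod_decode_inverse surj_pair)
  obtain a y where x: "x = case_nat a y" by (rule case_nat_cases)
  show "x \<in> side_game (enum_open p) (enum_open q)"
  proof (cases "e = 0")
    case True
    with i have p: "p j \<noteq> 0" and "w = 0 # d # list_decode (p j - 1)"
      by (auto simp: side_enum_def list_encode_eq simp del: list_encode.simps split: if_splits)
    moreover obtain b z where "y = case_nat b z" by (rule case_nat_cases)
    ultimately have x': "x = case_nat 0 (case_nat d z)" and "z \<in> cylinder (list_decode (p j - 1))"
      using i(2) by (auto simp: x)
    moreover have "p j = Suc (list_encode (list_decode (p j - 1)))" using p by simp
    ultimately have "z \<in> enum_open p" unfolding mem_enum_open by blast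
    then show ?thesis by (simp add: x')
  next
    case False
    with i have q: "q j \<noteq> 0" and "w = Suc d # list_decode (q j - 1)"
      by (auto simp: side_enum_def list_encode_eq simp del: list_encode.simps split: if_splits)
    then have x': "x = case_nat (Suc d) y" and "y \<in> cylinder (list_decode (q j - 1))"
      using i(2) by (auto simp: x)
    moreover have "q j = Suc (list_encode (list_decode (q j - 1)))" using q by simp
    ultimately have "y \<in> enum_open q" unfolding mem_enum_open by blast
    then show ?thesis by (simp add: x')
  qed
next
  fix x assume x: "x \<in> side_game (enum_open p) (enum_open q)"
  obtain a y where xy: "x = case_nat a y" by (rule case_nat_cases)
  show "x \<in> enum_open (side_enum p q)"
  proof (cases a)
    case 0
    obtain d z where y: "y = case_nat d z" by (rule case_nat_cases)
    with x 0 xy obtain j w where j: "p j = Suc (list_encode w)" "z \<in> cylinder w"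
      by (auto simp: mem_enum_open)
    have "side_enum p q (prod_encode (j, prod_encode (d, 0))) = Suc (list_encode (0 # d # w))"
      by (simp add: side_enum_def j)
    moreover have "x \<in> cylinder (0 # d # w)" using j by (simp add: xy y 0)
    ultimately show ?thesis unfolding mem_enum_open by blast
  next
    case (Suc d)
    with x xy obtain j w where j: "q j = Suc (list_encode w)" "y \<in> cylinder w"
      by (auto simp: mem_enum_open)
    have "side_enum p q (prod_encode (j, prod_encode (d, 1))) = Suc (list_encode (Suc d # w))"
      by (simp add: side_enum_def j)
    moreover have "x \<in> cylinder (Suc d # w)" using j by (simp add: xy Suc)
    ultimately show ?thesis unfolding mem_enum_open by blast
  qed
qed

text \<open>The first move of \<sigma> reveals the chosen side, and the residual strategy wins
  there.\<close>

lemma wins1_side_game: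
  assumes "wins1 (side_game W (- W)) \<sigma>"
  shows "wins1 W (after 0 (after 0 \<sigma>)) \<or> wins2 W (after (\<sigma> (list_encode [])) \<sigma>)"
proof (cases "\<sigma> (list_encode [])")
  case 0
  have "wins1 W (after 0 (after 0 \<sigma>))"
    unfolding wins1_def
  proof (intro allI impI)
    fix x assume "follows1 (after 0 (after 0 \<sigma>)) x"
    then have "follows1 \<sigma> (case_nat 0 (case_nat 0 x))"
      using 0 by (simp add: follows1_case_nat follows2_case_nat)
    then show "x \<in> W" using assms by (metis wins1_def side_game_0)
  qed
  then show ?thesis ..
next
  case (Suc a)
  have "wins2 W (after (Suc a) \<sigma>)"
    unfolding wins2_def
  proof (intro allI impI)
    fix x assume "follows2 (after (Suc a) \<sigma>) x"
    then have "follows1 \<sigma> (case_nat (Suc a) x)"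
      using Suc by (simp add: follows1_case_nat)
    then show "x \<notin> W" using assms by (metis wins1_def side_game_Suc ComplD)
  qed
  then show ?thesis using Suc by simp
qed

text \<open>Strategy stealing: a winning strategy of the second player would win \<open>W\<close> from both sides.\<close>

lemma not_wins2_side_game: "\<not> wins2 (side_game W (- W)) \<tau>"
proof
  assume w: "wins2 (side_game W (- W)) \<tau>"
  \<comment> \<open>Choosing the dummy move as the reply of \<tau> to 0 makes the prolonged run
    follow \<tau>.\<close>
  define d where "d = \<tau> (list_encode [0])"
  have "wins2 W (after d (after 0 \<tau>))"
    unfolding wins2_def
  proof (intro allI impI)
    fix x assume "follows2 (after d (after 0 \<tau>)) x"
    then have "follows2 \<tau> (case_nat 0 (case_nat d x))"
      by (simp add: follows1_case_nat follows2_case_nat d_def after_def)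
    then show "x \<notin> W" using w by (metis wins2_def side_game_0)
  qed
  \<comment> \<open>After a positive move the second player goes first and, to win, has to avoid
    \<open>- W\<close>.\<close>
  moreover have "wins1 W (after 1 \<tau>)"
    unfolding wins1_def
  proof (intro allI impI)
    fix x assume "follows1 (after 1 \<tau>) x"
    then have "follows2 \<tau> (case_nat (Suc 0) x)"
      by (simp add: follows2_case_nat)
    then show "x \<in> W" using w by (metis wins2_def side_game_Suc ComplI)
  qed
  ultimately show False using not_wins_both by blast
qed

lemma Det_Delta_le_FindWS_Delta: "Det_Delta \<le>\<^sub>W FindWS_Delta"
proof (rule weihrauch_leI)
  let ?H = "\<lambda>p. bpair (side_enum (bfst p) (bsnd p)) (side_enum (bsnd p) (bfst p))"
  \<comment> \<open>Both residual strategies are output: one of them wins, and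
    \<open>Det_Delta\<close> does not ask which.\<close>
  let ?K = "\<lambda>s. let \<sigma> = bsnd s in bpair (after 0 (after 0 \<sigma>)) (after (\<sigma> (list_encode [])) \<sigma>)"
  show "recursive ?H"
    unfolding bpair_def side_enum_def bfst_def bsnd_def by (intro recursive_intros)
  show "recursive ?K"
    unfolding bpair_def after_def bfst_def bsnd_def Let_def by (intro recursive_intros)
  fix p W assume "in_rep Det_Delta p = Some W"
  then have p: "enum_open (bfst p) = W" "enum_open (bsnd p) = - W"
    by (simp_all add: Det_Delta_def clopen_rep_eq_Some)
  then have 1: "clopen_rep (?H p) = Some (side_game W (- W))"
    by (simp add: clopen_rep_eq_Some enum_open_side_enum Compl_side_game)
  show "\<exists>y\<in>inputs FindWS_Delta. in_rep FindWS_Delta (?H p) = Some y \<and>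
        (\<forall>r z. out_rep FindWS_Delta r = Some z \<longrightarrow> z \<in> solutions FindWS_Delta y \<longrightarrow>
          (\<exists>w. out_rep Det_Delta (?K (bpair p r)) = Some w \<and> w \<in> solutions Det_Delta W))"
    using 1 clopen_rep_clopen[OF 1] not_wins2_side_game wins1_side_game
    by (auto simp: FindWS_Delta_def Det_Delta_def prod_rep_def baire_rep_def Let_def)
qed

section \<open>Paths of trees from clopen games\<close>

lemma enum_open_decidable:
  "enum_open (\<lambda>i. if P (list_decode i) then Suc i else 0) = {x. \<exists>n. P (restr x n)}"
proof (intro equalityI subsetI)
  fix x assume "x \<in> enum_open (\<lambda>i. if P (list_decode i) then Suc i else 0)"
  then obtain w where "P w" "restr x (length w) = w"
    by (auto simp: mem_enum_open cylinder_def split: if_splits)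
  then show "x \<in> {x. \<exists>n. P (restr x n)}" by (metis mem_Collect_eq)
next
  fix x assume "x \<in> {x. \<exists>n. P (restr x n)}"
  then obtain n where "P (restr x n)" by blast
  moreover have "x \<in> cylinder (restr x n)" by (simp add: cylinder_def)
  ultimately show "x \<in> enum_open (\<lambda>i. if P (list_decode i) then Suc i else 0)"
    unfolding mem_enum_open
    by (intro exI[of _ "list_encode (restr x n)"] exI[of _ "restr x n"]) simp
qed

lemma nth0_restr [simp]: "i < n \<Longrightarrow> nth0 (restr x n) i = x i"
  by (simp add: nth0_def)

lemma is_tree_restr:
  assumes "is_tree T" "restr x n \<in> T" "m \<le> n"
  shows "restr x m \<in> T"
proof -
  have "restr x n = restr x m @ drop m (restr x n)"
    using take_restr[of m x n] assms(3) by (metis append_take_drop_id min.absorb1)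
  then show ?thesis using assms(1,2) unfolding is_tree_def by metis
qed

text \<open>
  The challenge game for a tree with the unique path \<open>x\<close>: the second player asks for the value of
  \<open>x\<close> at \<open>n\<close>, the first player answers \<open>v\<close>, and then the players build sequences \<open>z\<close> and \<open>y\<close> with
  \<open>z n = v\<close> and \<open>y n \<noteq> v\<close>.  The first player wins if \<open>y\<close> leaves the tree before \<open>z\<close> does.  As \<open>y \<noteq> z\<close>,
  one of them has to leave it.
\<close>

definition with_value :: "nat list set \<Rightarrow> nat \<Rightarrow> nat \<Rightarrow> nat list set" where
  "with_value T n v = {w \<in> T. n < length w \<longrightarrow> nth0 w n = v}"

definition without_value :: "nat list set \<Rightarrow> nat \<Rightarrow> nat \<Rightarrow> nat list set" where
  "without_value T n v = {w \<in> T. n < length w \<longrightarrow> nth0 w n \<noteq> v}"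

text \<open>In a run, places 0 and 3 are dummies, place 1 holds the question and place 2 the answer;
  \<open>z\<close> occupies the places \<open>4 + 2 * j\<close> and \<open>y\<close> the places
  \<open>5 + 2 * j\<close>. The bound on \<open>k\<close> makes the predicate decidable.\<close>

definition challenge_won :: "nat list set \<Rightarrow> nat list \<Rightarrow> bool" where
  "challenge_won T r \<longleftrightarrow> (\<exists>k<length r. length r = 4 + 2 * k \<and>
     map (\<lambda>j. nth0 r (4 + 2 * j)) [0..<k] \<in> with_value T (nth0 r 1) (nth0 r 2) \<and>
     map (\<lambda>j. nth0 r (5 + 2 * j)) [0..<k] \<notin> without_value T (nth0 r 1) (nth0 r 2))"

text \<open>Here \<open>z\<close> is one entry longer than \<open>y\<close>, so that leaving at the
  same length counts as a loss of the first player.\<close>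

definition challenge_lost :: "nat list set \<Rightarrow> nat list \<Rightarrow> bool" where
  "challenge_lost T r \<longleftrightarrow> (\<exists>k<length r. length r = 6 + 2 * k \<and>
     map (\<lambda>j. nth0 r (4 + 2 * j)) [0..<Suc k] \<notin> with_value T (nth0 r 1) (nth0 r 2) \<and>
     map (\<lambda>j. nth0 r (5 + 2 * j)) [0..<k] \<in> without_value T (nth0 r 1) (nth0 r 2))"

lemma is_tree_with_value: "is_tree T \<Longrightarrow> is_tree (with_value T n v)"
  by (auto simp: is_tree_def with_value_def nth0_def nth_append)

lemma is_tree_without_value: "is_tree T \<Longrightarrow> is_tree (without_value T n v)"
  by (auto simp: is_tree_def without_value_def nth0_def nth_append)

lemma tree_paths_with_value: "tree_paths (with_value T n v) = {x \<in> tree_paths T. x n = v}"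
  by (auto simp: tree_paths_def with_value_def dest: spec[of _ "Suc n"])

lemma tree_paths_without_value: "tree_paths (without_value T n v) = {x \<in> tree_paths T. x n \<noteq> v}"
  by (auto simp: tree_paths_def without_value_def dest: spec[of _ "Suc n"])

lemma map_nth0_restr:
  assumes "\<And>j. j < k \<Longrightarrow> a + 2 * j < m"
  shows "map (\<lambda>j. nth0 (restr x m) (a + 2 * j)) [0..<k] = restr (\<lambda>j. x (a + 2 * j)) k"
  using assms by (auto simp: restr_def[of "\<lambda>j. x (a + 2 * j)"])

lemma challenge_won_restr:
  "(\<exists>m. challenge_won T (restr x m)) \<longleftrightarrow>
   (\<exists>k. restr (\<lambda>j. x (4 + 2 * j)) k \<in> with_value T (x 1) (x 2) \<and>
        restr (\<lambda>j. x (5 + 2 * j)) k \<notin> without_value T (x 1) (x 2))" (is "_ \<longleftrightarrow> (\<exists>k. ?P k)")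
proof -
  have "challenge_won T (restr x m) \<longleftrightarrow> (\<exists>k. m = 4 + 2 * k \<and> ?P k)" for m
    by (auto simp: challenge_won_def map_nth0_restr)
  then show ?thesis by blast
qed

lemma challenge_lost_restr:
  "(\<exists>m. challenge_lost T (restr x m)) \<longleftrightarrow>
   (\<exists>k. restr (\<lambda>j. x (4 + 2 * j)) (Suc k) \<notin> with_value T (x 1) (x 2) \<and>
        restr (\<lambda>j. x (5 + 2 * j)) k \<in> without_value T (x 1) (x 2))" (is "_ \<longleftrightarrow> (\<exists>k. ?P k)")
proof -
  have "challenge_lost T (restr x m) \<longleftrightarrow> (\<exists>k. m = 6 + 2 * k \<and> ?P k)" for m
    by (auto simp: challenge_lost_def map_nth0_restr simp del: upt_Suc)
  then show ?thesis by blast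
qed

definition challenge_game :: "nat list set \<Rightarrow> baire set" where
  "challenge_game T = {x. \<exists>m. challenge_won T (restr x m)}"

text \<open>Uniqueness of the path makes the game clopen: the two subtrees cannot both contain a
  path, so some exit occurs at a finite stage, and the order of the exits decides.\<close>

lemma Compl_challenge_game:
  assumes T: "is_tree T" "tree_paths T = {p}"
  shows "{x. \<exists>m. challenge_lost T (restr x m)} = - challenge_game T"
proof -
  have "(\<exists>m. challenge_lost T (restr x m)) \<longleftrightarrow> \<not> (\<exists>m. challenge_won T (restr x m))" for x
  proof -
    let ?A = "with_value T (x 1) (x 2)" and ?B = "without_value T (x 1) (x 2)"
    let ?z = "\<lambda>j. x (4 + 2 * j)" and ?y = "\<lambda>j. x (5 + 2 * j)"
    have A: "is_tree ?A" and B: "is_tree ?B"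
      using T by (simp_all add: is_tree_with_value is_tree_without_value)
    have "[] \<in> T" using T(2) by (force simp: tree_paths_def dest: spec[of _ 0])
    then have nil: "[] \<in> ?A" by (simp add: with_value_def)
    show ?thesis unfolding challenge_won_restr challenge_lost_restr
    proof (intro iffI notI)
      assume "\<exists>k. restr ?z (Suc k) \<notin> ?A \<and> restr ?y k \<in> ?B"
      then obtain k where k: "restr ?z (Suc k) \<notin> ?A" "restr ?y k \<in> ?B" by blast
      assume "\<exists>k. restr ?z k \<in> ?A \<and> restr ?y k \<notin> ?B"
      then obtain l where l: "restr ?z l \<in> ?A" "restr ?y l \<notin> ?B" by blast
      show False
        using is_tree_restr[OF A l(1), of "Suc k"] is_tree_restr[OF B k(2), of l] k l
        by (cases "l \<le> k") auto
    next
      assume no: "\<not> (\<exists>k. restr ?z k \<in> ?A \<and> restr ?y k \<notin> ?B)"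
      have "\<exists>k. restr ?z k \<notin> ?A"
      proof (rule ccontr)
        assume "\<not> (\<exists>k. restr ?z k \<notin> ?A)"
        with no have "?z \<in> tree_paths ?A" "?y \<in> tree_paths ?B" by (auto simp: tree_paths_def)
        then have "?z = p" "?y = p" "?z (x 1) = x 2" "?y (x 1) \<noteq> x 2"
          using T(2) unfolding tree_paths_with_value tree_paths_without_value by auto
        then show False by metis
      qed
      \<comment> \<open>The first exit of \<open>z\<close>. It is not at length 0, and one step
        earlier \<open>z\<close> is still inside, hence so is \<open>y\<close> by
        \<open>no\<close>.\<close>
      define k where "k = (LEAST k. restr ?z k \<notin> ?A)"
      have k: "restr ?z k \<notin> ?A" "\<And>j. j < k \<Longrightarrow> restr ?z j \<in> ?A"
        unfolding k_def using LeastI_ex[OF \<open>\<exists>k. restr ?z k \<notin> ?A\<close>] not_less_Least by blast+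
      with nil obtain j where "k = Suc j" by (cases k) auto
      with k no show "\<exists>k. restr ?z (Suc k) \<notin> ?A \<and> restr ?y k \<in> ?B" by blast
    qed
  qed
  then show ?thesis by (auto simp: challenge_game_def)
qed


lemma not_wins2_challenge_game:
  assumes T: "is_tree T" "tree_paths T = {p}"
  shows "\<not> wins2 (challenge_game T) \<tau>"
proof
  assume w: "wins2 (challenge_game T) \<tau>"
  \<comment> \<open>The honest strategy: answer with the value of \<open>p\<close> and then spell
    out \<open>p\<close> as \<open>z\<close>; \<open>y\<close> then has to leave first.\<close>
  define \<sigma> where "\<sigma> q = (let r = list_decode q in
    if length r = 2 then p (nth0 r 1) else p ((length r - 4) div 2))" for q
  obtain x where x: "follows1 \<sigma> x" "follows2 \<tau> x" by (rule follows_both)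
  have even: "x (2 * n) = \<sigma> (list_encode (restr x (2 * n)))" for n
    using x(1) by (simp add: follows1_def)
  have x2: "x 2 = p (x 1)" using even[of 1] by (simp add: \<sigma>_def)
  have "x (4 + 2 * j) = \<sigma> (list_encode (restr x (4 + 2 * j)))" for j
  proof -
    have "4 + 2 * j = 2 * (2 + j)" by simp
    then show ?thesis using even[of "2 + j"] by (simp only:)
  qed
  then have "x (4 + 2 * j) = p j" for j by (simp add: \<sigma>_def)
  then have z: "(\<lambda>j. x (4 + 2 * j)) = p" by (rule ext)
  have "p \<in> tree_paths (with_value T (x 1) (x 2))"
    using T(2) x2 by (simp add: tree_paths_with_value)
  moreover have "(\<lambda>j. x (5 + 2 * j)) \<notin> tree_paths (without_value T (x 1) (x 2))"
    using T(2) x2 by (auto simp: tree_paths_without_value)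
  ultimately have "x \<in> challenge_game T"
    unfolding challenge_game_def mem_Collect_eq challenge_won_restr z by (auto simp: tree_paths_def)
  then show False using w x(2) by (simp add: wins2_def)
qed

text \<open>A wrong answer could be punished by playing \<open>p\<close> itself as \<open>y\<close>:
  it never leaves the tree and differs from the answer at the place asked for.\<close>

lemma wins1_challenge_game:
  assumes T: "is_tree T" "tree_paths T = {p}" and w: "wins1 (challenge_game T) \<sigma>"
  shows "\<sigma> (list_encode [\<sigma> (list_encode []), n]) = p n"
proof (rule ccontr)
  assume neq: "\<sigma> (list_encode [\<sigma> (list_encode []), n]) \<noteq> p n"
  define \<tau> where "\<tau> q = (let r = list_decode q in
    if length r = 1 then n else p ((length r - 5) div 2))" for q
  obtain x where x: "follows1 \<sigma> x" "follows2 \<tau> x" by (rule follows_both)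
  have even: "x (2 * n) = \<sigma> (list_encode (restr x (2 * n)))" for n
    using x(1) by (simp add: follows1_def)
  have odd: "x (2 * n + 1) = \<tau> (list_encode (restr x (2 * n + 1)))" for n
    using x(2) by (simp add: follows2_def)
  have x1: "x 1 = n" using odd[of 0] by (simp add: \<tau>_def)
  have "restr x 2 = [x 0, x 1]" by (simp add: restr_def upt_rec)
  then have "x 2 \<noteq> p n"
    using even[of 1] even[of 0] neq x1 by simp
  moreover have "x (5 + 2 * j) = \<tau> (list_encode (restr x (5 + 2 * j)))" for j
  proof -
    have "5 + 2 * j = 2 * (2 + j) + 1" by simp
    then show ?thesis using odd[of "2 + j"] by (simp only:)
  qed
  then have "x (5 + 2 * j) = p j" for j by (simp add: \<tau>_def)
  then have y: "(\<lambda>j. x (5 + 2 * j)) = p" by (rule ext)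
  ultimately have "p \<in> tree_paths (without_value T (x 1) (x 2))"
    using T(2) x1 by (auto simp: tree_paths_without_value)
  then have "x \<notin> challenge_game T"
    unfolding challenge_game_def mem_Collect_eq challenge_won_restr y by (auto simp: tree_paths_def)
  then show False using w x(1) by (simp add: wins1_def)
qed

lemma UC_Baire_le_FindWS_Delta: "UC_Baire \<le>\<^sub>W FindWS_Delta"
proof (rule weihrauch_leI)
  let ?T = "\<lambda>p. {w. p (list_encode w) = 1}"
  let ?H = "\<lambda>p. bpair (\<lambda>i. if challenge_won (?T p) (list_decode i) then Suc i else 0)
    (\<lambda>i. if challenge_lost (?T p) (list_decode i) then Suc i else 0)"
  let ?K = "\<lambda>s n. bsnd s (list_encode [bsnd s (list_encode []), n])"
  show "recursive ?H"
    unfolding bpair_def challenge_won_def challenge_lost_def with_value_def without_value_def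
      mem_Collect_eq length_map length_upt
    by (intro recursive_intros)
  show "recursive ?K"
    unfolding bsnd_def by (intro recursive_intros)
  fix p T assume "in_rep UC_Baire p = Some T" "T \<in> inputs UC_Baire"
  then obtain x where T: "is_tree T" "tree_paths T = {x}" and p: "?T p = T"
    by (auto simp: UC_Baire_def tree_rep_def split: if_splits)
  have 1: "clopen_rep (?H p) = Some (challenge_game T)"
    using Compl_challenge_game[OF T]
    by (simp add: clopen_rep_eq_Some enum_open_decidable p[simplified] challenge_game_def)
  show "\<exists>y\<in>inputs FindWS_Delta. in_rep FindWS_Delta (?H p) = Some y \<and>
        (\<forall>r z. out_rep FindWS_Delta r = Some z \<longrightarrow> z \<in> solutions FindWS_Delta y \<longrightarrow>
          (\<exists>w. out_rep UC_Baire (?K (bpair p r)) = Some w \<and> w \<in> solutions UC_Baire T))"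
    using 1 clopen_rep_clopen[OF 1] not_wins2_challenge_game[OF T] wins1_challenge_game[OF T]
    by (auto simp: FindWS_Delta_def UC_Baire_def baire_rep_def T)
qed

section \<open>Strategies in open games from paths of trees\<close>

lemma triangle_strict_mono: "m < n \<Longrightarrow> triangle m < triangle n"
  using triangle_mono[of "Suc m" n] by simp

text \<open>Consequently, when the position with code \<open>length s\<close> is up for an answer,
  \<open>s\<close> already has an entry for each of its proper prefixes.\<close>

lemma list_encode_take_less: "j < length u \<Longrightarrow> list_encode (take j u) < list_encode u"
proof (induction u arbitrary: j)
  case (Cons a u)
  then show ?case
    by (cases j) (auto simp: prod_encode_def intro!: triangle_strict_mono)
qed simp

text \<open>The entry of \<open>s\<close> at the code of a position is the answer of the second
  player there; \<open>w\<close> is a string whose odd entries all come from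
  \<open>s\<close>.\<close>

definition answers :: "nat list \<Rightarrow> nat list \<Rightarrow> bool" where
  "answers s w \<longleftrightarrow> (\<forall>j<length w. odd j \<longrightarrow>
     list_encode (take j w) < length s \<and> nth0 s (list_encode (take j w)) = nth0 w j)"

definition secured :: "baire \<Rightarrow> nat list \<Rightarrow> bool" where
  "secured p s \<longleftrightarrow> (\<exists>i<length s. p i \<noteq> 0 \<and> answers s (list_decode (p i - 1)))"

definition target :: "baire \<Rightarrow> nat list \<Rightarrow> nat list" where
  "target p s =
     list_decode (p (search (\<lambda>i. p i \<noteq> 0 \<and> answers s (list_decode (p i - 1))) (length s)) - 1)"

lemma target:
  assumes "secured p s"
  shows "\<exists>i. p i = Suc (list_encode (target p s))" "answers s (target p s)"
proof -
  let ?P = "\<lambda>i. p i \<noteq> 0 \<and> answers s (list_decode (p i - 1))"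
  obtain i where "i < length s" "?P i" using assms unfolding secured_def by blast
  from search[of ?P, OF this(2,1)]
  have P: "?P (search ?P (length s))" by blast
  then have "p (search ?P (length s)) = Suc (list_encode (target p s))" unfolding target_def by simp
  then show "\<exists>i. p i = Suc (list_encode (target p s))" by blast
  show "answers s (target p s)" using P unfolding target_def by blast
qed

text \<open>Longer sequences are smaller, so induction proceeds from the secured sequences back to
  the root.\<close>

definition extension_rel :: "baire \<Rightarrow> (nat list \<times> nat list) set" where
  "extension_rel p = {(s @ [k], s) | s k. \<not> secured p s}"

lemma wf_extension_rel:
  assumes "\<nexists>\<tau>. wins2 (enum_open p) \<tau>"
  shows "wf (extension_rel p)"
  unfolding wf_iff_no_infinite_down_chain
proof
  assume "\<exists>f. \<forall>i. (f (Suc i), f i) \<in> extension_rel p"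
  then obtain f where f: "\<And>i. (f (Suc i), f i) \<in> extension_rel p" by blast
  have pre: "\<exists>v. f j = f i @ v" if "i \<le> j" for i j
    using that
  proof (induction j rule: dec_induct)
    case (step j)
    then show ?case using f[of j] by (auto simp: extension_rel_def)
  qed simp
  have len: "n \<le> length (f n)" for n
  proof (induction n)
    case (Suc n)
    then show ?case using f[of n] by (auto simp: extension_rel_def)
  qed simp
  \<comment> \<open>The members of the chain extend each other and \<open>f (Suc n)\<close> has an
    entry at \<open>n\<close>, so \<tau> is their common limit.\<close>
  define \<tau> where "\<tau> n = f (Suc n) ! n" for n
  have \<tau>: "f N ! n = \<tau> n" if "n < length (f N)" for n N
  proof (cases "N \<le> Suc n")
    case True
    then show ?thesis using pre[OF True] that by (auto simp: \<tau>_def nth_append)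
  next
    case False
    then show ?thesis using pre[of "Suc n" N] len[of "Suc n"] by (auto simp: \<tau>_def nth_append)
  qed
  have "wins2 (enum_open p) \<tau>"
    unfolding wins2_def
  proof (intro allI impI notI)
    fix y assume y: "follows2 \<tau> y" "y \<in> enum_open p"
    then obtain i w where i: "p i = Suc (list_encode w)" and w: "restr y (length w) = w"
      by (auto simp: mem_enum_open cylinder_def)
    \<comment> \<open>Large enough for \<open>f N\<close> to cover the index \<open>i\<close> and
      the codes of all proper prefixes of \<open>w\<close>.\<close>
    define N where "N = Suc (i + list_encode w)"
    have "answers (f N) w"
      unfolding answers_def
    proof (intro allI impI)
      fix j assume j: "j < length w" "odd j"
      then have take: "take j w = restr y j" using w by (metis take_restr min.absorb1 less_imp_le)
      have less: "list_encode (take j w) < length (f N)"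
        using list_encode_take_less[OF j(1)] len[of N] by (simp add: N_def)
      moreover have "y j = \<tau> (list_encode (restr y j))"
        using y(1) j(2) unfolding follows2_def by (metis oddE)
      moreover have "y j = w ! j" using w j by (metis nth_restr)
      ultimately show "list_encode (take j w) < length (f N) \<and>
          nth0 (f N) (list_encode (take j w)) = nth0 w j"
        using j \<tau>[OF less] by (simp add: nth0_def take)
    qed
    then have "secured p (f N)"
      unfolding secured_def using i len[of N] by (intro exI[of _ i]) (simp add: N_def)
    then show False using f[of N] by (auto simp: extension_rel_def)
  qed
  then show False using assms by blast
qed

section \<open>Bar recursion for strategies of the first player\<close>

definition reaches :: "nat list \<Rightarrow> baire \<Rightarrow> nat list \<Rightarrow> bool" where
  "reaches s \<sigma> u \<longleftrightarrow> odd (length u) \<and> (\<forall>j<length u.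
     if even j then \<sigma> (list_encode (take j u)) = nth0 u j
     else nth0 s (list_encode (take j u)) = nth0 u j)"

text \<open>Reads off from the position \<open>q\<close> how the second player answered at
  \<open>u\<close>. The default 0 applies before that answer is given and at positions that bypass
  \<open>u\<close>.\<close>

definition reply :: "nat list \<Rightarrow> nat \<Rightarrow> nat" where
  "reply u q = (if length u < length (list_decode q) \<and> take (length u) (list_decode q) = u
     then nth0 (list_decode q) (length u) else 0)"

text \<open>The choice of the least avoiding \<open>k\<close> makes the entry unique, on which the
  uniqueness of the path rests.\<close>

definition branch :: "nat list \<Rightarrow> (nat \<Rightarrow> baire) \<Rightarrow> nat" where
  "branch s R = (if \<forall>k. reaches s (R k) (list_decode (length s)) then 0
     else Suc (LEAST k. \<not> reaches s (R k) (list_decode (length s))))"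

text \<open>One step of the bar recursion, from the rows \<open>R\<close> of the immediate
  extensions. At a secured \<open>s\<close> the first player recites the target, and the branch
  entry is fixed as 0 to keep the row unique.\<close>

definition node :: "baire \<Rightarrow> nat list \<Rightarrow> (nat \<Rightarrow> baire) \<Rightarrow> baire" where
  "node p s R =
     (if secured p s then case_nat 0 (\<lambda>q. nth0 (target p s) (length (list_decode q)))
      else case_nat (branch s R)
        (\<lambda>q. R (case branch s R of 0 \<Rightarrow> reply (list_decode (length s)) q | Suc k \<Rightarrow> k) q))"

text \<open>In the assignment of strategies, the entry at \<open>idx s 0\<close> is the value of \<open>branch\<close> at \<open>s\<close> and the
  entry at \<open>idx s (Suc q)\<close> the move of the strategy for \<open>s\<close> at the position coded by \<open>q\<close>.\<close>

definition idx :: "nat list \<Rightarrow> nat \<Rightarrow> nat" where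
  "idx s q = prod_encode (list_encode s, q)"

definition strategy_at :: "baire \<Rightarrow> nat list \<Rightarrow> baire" where
  "strategy_at x s = (\<lambda>q. x (idx s (Suc q)))"

definition coherent :: "baire \<Rightarrow> baire \<Rightarrow> bool" where
  "coherent p x \<longleftrightarrow> (\<forall>s. (\<lambda>q. x (idx s q)) = node p s (\<lambda>k. strategy_at x (s @ [k])))"

lemma branch_eq_0: "branch s R = 0 \<longleftrightarrow> (\<forall>k. reaches s (R k) (list_decode (length s)))"
  by (simp add: branch_def)

lemma branch_eq_Suc:
  "branch s R = Suc k \<longleftrightarrow> \<not> reaches s (R k) (list_decode (length s)) \<and>
     (\<forall>j<k. reaches s (R j) (list_decode (length s)))"
proof -
  have "(LEAST k. \<not> P k) = k \<longleftrightarrow> \<not> P k \<and> (\<forall>j<k. P j)" if "\<not> (\<forall>k. P k)" for P :: "nat \<Rightarrow> bool"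
    using that LeastI_ex[of "\<lambda>k. \<not> P k"] not_less_Least[of _ "\<lambda>k. \<not> P k"]
    by (metis linorder_neqE_nat)
  then show ?thesis by (auto simp: branch_def)
qed

lemma coherent_unique:
  assumes "wf (extension_rel p)" "coherent p x" "coherent p y"
  shows "x = y"
proof -
  have "(\<lambda>q. x (idx s q)) = (\<lambda>q. y (idx s q))" for s
    using assms(1)
  proof (induction s rule: wf_induct_rule)
    case (less s)
    show ?case
    proof (cases "secured p s")
      case True
      then show ?thesis using assms(2,3) by (simp add: coherent_def node_def)
    next
      case False
      then have "(\<lambda>q. x (idx (s @ [k]) q)) = (\<lambda>q. y (idx (s @ [k]) q))" for k
        by (intro less) (auto simp: extension_rel_def)
      then have "strategy_at x (s @ [k]) = strategy_at y (s @ [k])" for k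
        unfolding strategy_at_def by metis
      then show ?thesis using assms(2,3) by (simp add: coherent_def)
    qed
  qed
  then have "x (idx s q) = y (idx s q)" for s q by metis
  then have "x z = y z" for z
    by (metis idx_def list_decode_inverse prod_decode_inverse surj_pair)
  then show ?thesis by blast
qed

lemma coherent_exists:
  assumes "wf (extension_rel p)"
  shows "\<exists>x. coherent p x"
proof -
  define rows where "rows = wfrec (extension_rel p) (\<lambda>R s. node p s (\<lambda>k q. R (s @ [k]) (Suc q)))"
  define x where "x z = rows (list_decode (fst (prod_decode z))) (snd (prod_decode z))" for z
  have x: "x (idx s q) = rows s q" for s q by (simp add: x_def idx_def)
  have "rows s = node p s (\<lambda>k q. rows (s @ [k]) (Suc q))" for s
  proof (cases "secured p s")
    \<comment> \<open>Here the extensions are not below \<open>s\<close>, so \<open>wfrec\<close>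
      cuts them off; this is harmless, as \<open>node\<close> ignores \<open>R\<close> at a secured
      \<open>s\<close>.\<close>
    case True
    then show ?thesis unfolding rows_def by (subst wfrec[OF assms]) (simp add: node_def)
  next
    case False
    then have "(s @ [k], s) \<in> extension_rel p" for k by (auto simp: extension_rel_def)
    then show ?thesis unfolding rows_def by (subst wfrec[OF assms]) (simp add: cut_apply)
  qed
  then have "coherent p x" unfolding coherent_def strategy_at_def x by blast
  then show ?thesis by blast
qed

definition obeys :: "nat list \<Rightarrow> baire \<Rightarrow> bool" where
  "obeys s y \<longleftrightarrow> (\<forall>n. odd n \<longrightarrow> list_encode (restr y n) < length s \<longrightarrow>
     y n = nth0 s (list_encode (restr y n)))"

lemma follows1_even: "follows1 \<sigma> y \<longleftrightarrow> (\<forall>n. even n \<longrightarrow> y n = \<sigma> (list_encode (restr y n)))"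
  unfolding follows1_def by (metis evenE dvd_triv_left)

lemma obeys_snoc:
  assumes "obeys s y" "\<And>n. odd n \<Longrightarrow> restr y n = list_decode (length s) \<Longrightarrow> y n = k"
  shows "obeys (s @ [k]) y"
  unfolding obeys_def
proof (intro allI impI)
  fix n assume n: "odd n" "list_encode (restr y n) < length (s @ [k])"
  show "y n = nth0 (s @ [k]) (list_encode (restr y n))"
  proof (cases "list_encode (restr y n) = length s")
    case True
    then have "restr y n = list_decode (length s)" by (metis list_encode_inverse)
    then show ?thesis using assms(2) n(1) True by (simp add: nth0_def)
  next
    case False
    then show ?thesis using assms(1) n by (auto simp: obeys_def nth0_def nth_append)
  qed
qed

text \<open>At a secured \<open>s\<close> the run is forced into the target. Otherwise it obeys some
  \<open>s @ [k]\<close> and follows the strategy belonging to it, so the induction hypothesis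
  applies.\<close>

lemma strategy_at_wins:
  assumes wf: "wf (extension_rel p)" and x: "coherent p x"
  shows "follows1 (strategy_at x s) y \<Longrightarrow> obeys s y \<Longrightarrow> y \<in> enum_open p"
  using wf
proof (induction s rule: wf_induct_rule)
  case (less s)
  have node: "x (idx s q) = node p s (\<lambda>k. strategy_at x (s @ [k])) q" for q
    using x unfolding coherent_def by metis
  have y: "even n \<Longrightarrow> y n = strategy_at x s (list_encode (restr y n))" for n
    using less.prems(1) by (simp add: follows1_even)
  show ?case
  proof (cases "secured p s")
    case True
    let ?w = "target p s"
    have "restr y n = take n ?w" if "n \<le> length ?w" for n
      using that
    proof (induction n)
      case (Suc n)
      then have n: "restr y n = take n ?w" "n < length ?w" by simp_all
      have "y n = ?w ! n"
      proof (cases "even n")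
        case even: True
        show ?thesis using y[OF even] n(2) True by (simp add: strategy_at_def node node_def nth0_def)
      next
        case False
        then show ?thesis using less.prems(2) target(2)[OF True] n unfolding obeys_def answers_def
          by (metis nth0_def)
      qed
      then show ?case using n by (simp add: restr_Suc take_Suc_conv_app_nth)
    qed simp
    then have "y \<in> cylinder ?w" by (simp add: cylinder_def)
    then show ?thesis using target(1)[OF True] unfolding mem_enum_open by blast
  next
    case False
    let ?R = "\<lambda>k. strategy_at x (s @ [k])"
    let ?u = "list_decode (length s)"
    have IH: "y \<in> enum_open p" if "follows1 (?R k) y" "obeys (s @ [k]) y" for k
      using that False by (intro less.IH) (auto simp: extension_rel_def)
    show ?thesis
    proof (cases "branch s ?R")
      case (Suc k)
      then have f: "follows1 (?R k) y"
        using y False unfolding follows1_even by (simp add: strategy_at_def node node_def)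
      \<comment> \<open>A passage of the run through \<open>?u\<close> at a move of the second
        player would show that \<open>?R k\<close> reaches \<open>?u\<close>, against the choice of
        \<open>k\<close>; so the new requirement never applies.\<close>
      have "obeys (s @ [k]) y"
      proof (rule obeys_snoc[OF less.prems(2)])
        fix n assume n: "odd n" "restr y n = ?u"
        then have len: "length ?u = n" by (metis length_restr)
        have "reaches s (?R k) ?u"
          unfolding reaches_def len
        proof (intro conjI allI impI)
          fix j assume j: "j < n"
          have tk: "take j ?u = restr y j" and nth: "nth0 ?u j = y j"
            using j by (simp_all add: n(2)[symmetric])
          have "list_encode (take j ?u) < length s"
            using list_encode_take_less[of j ?u] j by (simp add: len)
          then show "if even j then ?R k (list_encode (take j ?u)) = nth0 ?u j
              else nth0 s (list_encode (take j ?u)) = nth0 ?u j"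
            using f less.prems(2) by (simp add: tk nth follows1_even obeys_def)
        qed (rule n)
        then show "y n = k" using Suc by (simp add: branch_eq_Suc)
      qed
      with f show ?thesis by (rule IH)
    next
      case 0
      then have reach: "reaches s (?R k) ?u" for k by (simp add: branch_eq_0)
      then have odd: "odd (length ?u)" by (simp add: reaches_def)
      have y': "y n = ?R (reply ?u (list_encode (restr y n))) (list_encode (restr y n))"
        if "even n" for n
        using y[OF that] False 0 by (simp add: strategy_at_def node node_def)
      \<comment> \<open>The answer that the run actually gives at \<open>?u\<close>; if it bypasses
        \<open>?u\<close>, the value 0 agrees with the default of \<open>reply\<close>.\<close>
      define k where "k = (if restr y (length ?u) = ?u then y (length ?u) else 0)"
      have "obeys (s @ [k]) y"
      proof (rule obeys_snoc[OF less.prems(2)])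
        fix n assume n: "odd n" "restr y n = ?u"
        then have "length ?u = n" by (metis length_restr)
        then show "y n = k" using n by (simp add: k_def)
      qed
      moreover have "follows1 (?R k) y"
        unfolding follows1_even
      proof (intro allI impI)
        fix n :: nat assume n: "even n"
        show "y n = ?R k (list_encode (restr y n))"
        proof (cases "length ?u < n")
          case True
          then have "reply ?u (list_encode (restr y n)) = k" by (simp add: reply_def k_def)
          then show ?thesis using y'[OF n] by simp
        next
          \<comment> \<open>No answer at \<open>?u\<close> is visible yet, so the run uses
            \<open>?R 0\<close>. All the \<open>?R j\<close> reach \<open>?u\<close> and hence agree
            on the way there; if the run bypasses \<open>?u\<close>, then \<open>k\<close> is
            0.\<close>
          case nless: False
          then have r: "reply ?u (list_encode (restr y n)) = 0" by (simp add: reply_def)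
          have less: "n < length ?u" using nless n odd by (metis linorder_neqE_nat)
          show ?thesis
          proof (cases "restr y (length ?u) = ?u")
            case True
            then have "take n ?u = restr y n" using less by (metis take_restr min.absorb1 less_imp_le)
            moreover have "?R j (list_encode (take n ?u)) = nth0 ?u n" for j
              using reach[of j] less n by (auto simp: reaches_def)
            ultimately show ?thesis using y'[OF n] r by metis
          next
            case False
            then show ?thesis using y'[OF n] r by (simp add: k_def)
          qed
        qed
      qed
      ultimately show ?thesis using IH by blast
    qed
  qed
qed

section \<open>The tree of coherent assignments\<close>

text \<open>Partial information about a sequence: \<open>0\<close> stands for unknown and \<open>Suc v\<close> for the value \<open>v\<close>.\<close>

definition known :: "nat list \<Rightarrow> baire" where
  "known w i = (if i < length w then Suc (nth0 w i) else 0)"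

text \<open>Evidence for \<open>reaches\<close> from partial values, with the strategy stored in row
  \<open>t\<close>. Together with \<open>surely_avoids\<close> it leaves cases open while values are
  unknown; under total information the two are complementary.\<close>

definition surely_reaches :: "baire \<Rightarrow> nat list \<Rightarrow> nat list \<Rightarrow> nat list \<Rightarrow> bool" where
  "surely_reaches L s t u \<longleftrightarrow> odd (length u) \<and> (\<forall>j<length u.
     if even j then L (idx t (Suc (list_encode (take j u)))) = Suc (nth0 u j)
     else nth0 s (list_encode (take j u)) = nth0 u j)"

definition surely_avoids :: "baire \<Rightarrow> nat list \<Rightarrow> nat list \<Rightarrow> nat list \<Rightarrow> bool" where
  "surely_avoids L s t u \<longleftrightarrow> even (length u) \<or> (\<exists>j<length u.
     if even j then L (idx t (Suc (list_encode (take j u)))) \<noteq> 0 \<and>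
       L (idx t (Suc (list_encode (take j u)))) \<noteq> Suc (nth0 u j)
     else nth0 s (list_encode (take j u)) \<noteq> nth0 u j)"

definition surely_differ :: "baire \<Rightarrow> nat \<Rightarrow> nat \<Rightarrow> bool" where
  "surely_differ L i j \<longleftrightarrow> L i \<noteq> 0 \<and> L j \<noteq> 0 \<and> L i \<noteq> L j"

text \<open>A violation is only reported once the known values exclude every coherent continuation at the
  given indices, so it persists when more values become known.\<close>

definition violation :: "baire \<Rightarrow> baire \<Rightarrow> nat list \<Rightarrow> nat \<Rightarrow> nat \<Rightarrow> bool" where
  "violation p L s k q \<longleftrightarrow>
     (if secured p s
      then L (idx s 0) \<noteq> 0 \<and> L (idx s 0) \<noteq> Suc 0 \<or>
        L (idx s (Suc q)) \<noteq> 0 \<and>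
        L (idx s (Suc q)) \<noteq> Suc (nth0 (target p s) (length (list_decode q)))
      else L (idx s 0) = Suc 0 \<and>
          (surely_avoids L s (s @ [k]) (list_decode (length s)) \<or>
           surely_differ L (idx s (Suc q))
             (idx (s @ [reply (list_decode (length s)) q]) (Suc q))) \<or>
        L (idx s 0) = Suc (Suc k) \<and>
          (surely_reaches L s (s @ [k]) (list_decode (length s)) \<or>
           (\<exists>j<k. surely_avoids L s (s @ [j]) (list_decode (length s))) \<or>
           surely_differ L (idx s (Suc q)) (idx (s @ [k]) (Suc q))))"

text \<open>Only the tests numbered below the length of the string are run, which makes membership
  decidable; along a path every test is run eventually.\<close>

definition coherence_tree :: "baire \<Rightarrow> nat list set" where
  "coherence_tree p = {w. \<forall>m<length w. \<not> violation p (known w) (list_decode (fst (prod_decode m)))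
     (fst (prod_decode (snd (prod_decode m)))) (snd (prod_decode (snd (prod_decode m))))}"

text \<open>The tests for a fixed \<open>s\<close> together express the equation for its row. At an
  unsecured \<open>s\<close> with branch entry 0, \<open>k\<close> ranges over all extensions; with
  branch entry \<open>Suc j\<close> only the tests with \<open>k = j\<close> have content.\<close>

lemma coherent_iff_no_violation:
  "coherent p x \<longleftrightarrow> (\<forall>s k q. \<not> violation p (\<lambda>i. Suc (x i)) s k q)"
proof -
  have "(\<lambda>q. x (idx s q)) = node p s (\<lambda>k. strategy_at x (s @ [k])) \<longleftrightarrow>
      (\<forall>k q. \<not> violation p (\<lambda>i. Suc (x i)) s k q)" for s
  proof -
    let ?R = "\<lambda>k. strategy_at x (s @ [k])" and ?u = "list_decode (length s)"
    have split: "(\<lambda>q. x (idx s q)) = case_nat a f \<longleftrightarrow>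
        x (idx s 0) = a \<and> (\<forall>q. x (idx s (Suc q)) = f q)" for a f
      by (auto simp: fun_eq_iff split: nat.split)
    have reach: "surely_reaches (\<lambda>i. Suc (x i)) s (s @ [k]) u \<longleftrightarrow> reaches s (?R k) u" for k u
      by (simp add: surely_reaches_def reaches_def strategy_at_def)
    have avoid: "surely_avoids (\<lambda>i. Suc (x i)) s (s @ [k]) u \<longleftrightarrow> \<not> reaches s (?R k) u" for k u
      by (auto simp: surely_avoids_def reaches_def strategy_at_def split: if_splits)
    show ?thesis
    proof (cases "secured p s")
      case True
      then show ?thesis by (auto simp: node_def violation_def split)
    next
      case False
      show ?thesis
      proof (cases "x (idx s 0)")
        case 0
        then have "(\<lambda>q. x (idx s q)) = node p s ?R \<longleftrightarrow> (\<forall>k. reaches s (?R k) ?u) \<and>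
            (\<forall>q. x (idx s (Suc q)) = ?R (reply ?u q) q)"
          using False branch_eq_0[of s ?R] by (auto simp: node_def split)
        also have "\<dots> \<longleftrightarrow> (\<forall>k q. \<not> violation p (\<lambda>i. Suc (x i)) s k q)"
          using 0 False by (auto simp: violation_def reach avoid surely_differ_def strategy_at_def)
        finally show ?thesis .
      next
        case (Suc k)
        then have "(\<lambda>q. x (idx s q)) = node p s ?R \<longleftrightarrow> branch s ?R = Suc k \<and>
            (\<forall>q. x (idx s (Suc q)) = ?R k q)"
          using False by (cases "branch s ?R = Suc k") (auto simp: node_def split)
        also have "\<dots> \<longleftrightarrow> (\<forall>k q. \<not> violation p (\<lambda>i. Suc (x i)) s k q)"
        proof -
          have "violation p (\<lambda>i. Suc (x i)) s k' q \<longleftrightarrow> k' = k \<and> (reaches s (?R k) ?u \<or>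
              (\<exists>j<k. \<not> reaches s (?R j) ?u) \<or> x (idx s (Suc q)) \<noteq> ?R k q)" for k' q
            using Suc False
            by (auto simp: violation_def reach avoid surely_differ_def strategy_at_def)
          then show ?thesis by (auto simp: branch_eq_Suc)
        qed
        finally show ?thesis .
      qed
    qed
  qed
  then show ?thesis by (simp add: coherent_def)
qed

text \<open>Values enter only through conditions that known values settle for good. This gives both
  prefix closure of the tree and the absence of violations on prefixes of coherent
  sequences.\<close>

lemma violation_mono:
  assumes "violation p L s k q" and L: "\<And>i. L i \<noteq> 0 \<Longrightarrow> L' i = L i"
  shows "violation p L' s k q"
proof -
  have Suc: "L i = Suc v \<Longrightarrow> L' i = Suc v" for i v using L[of i] by simp
  have neq: "L i \<noteq> 0 \<Longrightarrow> L i \<noteq> v \<Longrightarrow> L' i \<noteq> 0 \<and> L' i \<noteq> v" for i v using L[of i] by simp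
  have reach: "surely_reaches L s t u \<Longrightarrow> surely_reaches L' s t u" for t u
    using Suc unfolding surely_reaches_def by meson
  have avoid: "surely_avoids L s t u \<Longrightarrow> surely_avoids L' s t u" for t u
    using neq unfolding surely_avoids_def by meson
  have differ: "surely_differ L i j \<Longrightarrow> surely_differ L' i j" for i j
    using L[of i] L[of j] unfolding surely_differ_def by simp
  show ?thesis
  proof (cases "secured p s")
    case True
    then show ?thesis using assms(1) neq unfolding violation_def by (simp only: if_True) meson
  next
    case False
    then show ?thesis
      using assms(1) Suc reach avoid differ unfolding violation_def by (simp only: if_False) meson
  qed
qed

lemma eventually_known: "\<forall>\<^sub>F n in sequentially. known (restr x n) i = Suc (x i)"
  using eventually_gt_at_top[of i] by eventually_elim (simp add: known_def)

text \<open>A violation rests on finitely many entries of \<open>x\<close>, and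
  \<open>secured\<close> and \<open>target\<close> do not look at \<open>x\<close>; hence all
  sufficiently long prefixes reveal it.\<close>

lemma eventually_violation:
  assumes "violation p (\<lambda>i. Suc (x i)) s k q"
  shows "\<forall>\<^sub>F n in sequentially. violation p (known (restr x n)) s k q"
proof -
  have eq: "\<forall>\<^sub>F n in sequentially. known (restr x n) i = v" if "Suc (x i) = v" for i v
    using eventually_known[of x i] that by simp
  have reach: "\<forall>\<^sub>F n in sequentially. surely_reaches (known (restr x n)) s t u"
    if "surely_reaches (\<lambda>i. Suc (x i)) s t u" for t u
  proof -
    have "\<forall>\<^sub>F n in sequentially. \<forall>j\<in>{..<length u}.
        known (restr x n) (idx t (Suc (list_encode (take j u)))) =
        Suc (x (idx t (Suc (list_encode (take j u)))))"
      by (intro eventually_ball_finite) (simp_all add: eventually_known)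
    then show ?thesis
      by eventually_elim (use that in \<open>auto simp: surely_reaches_def\<close>)
  qed
  have avoid: "\<forall>\<^sub>F n in sequentially. surely_avoids (known (restr x n)) s t u"
    if "surely_avoids (\<lambda>i. Suc (x i)) s t u" for t u
  proof -
    have "\<forall>\<^sub>F n in sequentially. \<forall>j\<in>{..<length u}.
        known (restr x n) (idx t (Suc (list_encode (take j u)))) =
        Suc (x (idx t (Suc (list_encode (take j u)))))"
      by (intro eventually_ball_finite) (simp_all add: eventually_known)
    then show ?thesis
      by eventually_elim (use that in \<open>auto simp: surely_avoids_def\<close>)
  qed
  have differ: "\<forall>\<^sub>F n in sequentially. surely_differ (known (restr x n)) i j"
    if "surely_differ (\<lambda>i. Suc (x i)) i j" for i j
    using eventually_known[of x i] eventually_known[of x j]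
    by eventually_elim (use that in \<open>auto simp: surely_differ_def\<close>)
  show ?thesis
  proof (cases "secured p s")
    case True
    show ?thesis
      using eventually_known[of x "idx s 0"] eventually_known[of x "idx s (Suc q)"]
      by eventually_elim (use assms True in \<open>auto simp: violation_def\<close>)
  next
    case False
    let ?u = "list_decode (length s)"
    consider (a) "x (idx s 0) = 0" "surely_avoids (\<lambda>i. Suc (x i)) s (s @ [k]) ?u"
      | (b) "x (idx s 0) = 0"
        "surely_differ (\<lambda>i. Suc (x i)) (idx s (Suc q)) (idx (s @ [reply ?u q]) (Suc q))"
      | (c) "x (idx s 0) = Suc k" "surely_reaches (\<lambda>i. Suc (x i)) s (s @ [k]) ?u"
      | (d) j where "x (idx s 0) = Suc k" "j < k" "surely_avoids (\<lambda>i. Suc (x i)) s (s @ [j]) ?u"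
      | (e) "x (idx s 0) = Suc k"
        "surely_differ (\<lambda>i. Suc (x i)) (idx s (Suc q)) (idx (s @ [k]) (Suc q))"
      using assms False by (auto simp: violation_def)
    then show ?thesis
    proof cases
      case a
      from eventually_known[of x "idx s 0"] avoid[OF a(2)] show ?thesis
        by eventually_elim (use False a in \<open>simp add: violation_def\<close>)
    next
      case b
      from eventually_known[of x "idx s 0"] differ[OF b(2)] show ?thesis
        by eventually_elim (use False b in \<open>simp add: violation_def\<close>)
    next
      case c
      from eventually_known[of x "idx s 0"] reach[OF c(2)] show ?thesis
        by eventually_elim (use False c in \<open>simp add: violation_def\<close>)
    next
      case d
      from eventually_known[of x "idx s 0"] avoid[OF d(3)] show ?thesis
        by eventually_elim (use False d in \<open>auto simp: violation_def\<close>)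
    next
      case e
      from eventually_known[of x "idx s 0"] differ[OF e(2)] show ?thesis
        by eventually_elim (use False e in \<open>simp add: violation_def\<close>)
    qed
  qed
qed

lemma is_tree_coherence_tree: "is_tree (coherence_tree p)"
  unfolding is_tree_def coherence_tree_def mem_Collect_eq
proof (intro allI impI notI)
  fix u v m
  let ?s = "list_decode (fst (prod_decode m))" and ?k = "fst (prod_decode (snd (prod_decode m)))"
    and ?q = "snd (prod_decode (snd (prod_decode m)))"
  assume *: "\<forall>m<length (u @ v). \<not> violation p (known (u @ v)) (list_decode (fst (prod_decode m)))
     (fst (prod_decode (snd (prod_decode m)))) (snd (prod_decode (snd (prod_decode m))))"
    and m: "m < length u" and viol: "violation p (known u) ?s ?k ?q"
  have "violation p (known (u @ v)) ?s ?k ?q"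
    using viol by (rule violation_mono) (simp add: known_def nth0_def nth_append split: if_splits)
  then show False using * m by simp
qed

lemma tree_paths_coherence_tree: "tree_paths (coherence_tree p) = {x. coherent p x}"
proof -
  have "(\<forall>n. restr x n \<in> coherence_tree p) \<longleftrightarrow> coherent p x" for x
  proof
    assume path: "\<forall>n. restr x n \<in> coherence_tree p"
    have "\<not> violation p (\<lambda>i. Suc (x i)) s k q" for s k q
    proof
      let ?m = "prod_encode (list_encode s, prod_encode (k, q))"
      assume "violation p (\<lambda>i. Suc (x i)) s k q"
      from eventually_violation[OF this] eventually_gt_at_top[of ?m]
      have "\<forall>\<^sub>F n in sequentially. violation p (known (restr x n)) s k q \<and> ?m < n"
        by (rule eventually_conj)
      from eventually_happens'[OF sequentially_bot this]
      obtain n where n: "violation p (known (restr x n)) s k q" "?m < n" by blast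
      then show False
        using path[THEN spec[of _ n]] unfolding coherence_tree_def mem_Collect_eq
        by (auto dest: spec[of _ ?m])
    qed
    then show "coherent p x" by (simp add: coherent_iff_no_violation)
  next
    assume x: "coherent p x"
    have "\<not> violation p (known (restr x n)) s k q" for n s k q
    proof
      assume "violation p (known (restr x n)) s k q"
      then have "violation p (\<lambda>i. Suc (x i)) s k q"
        by (rule violation_mono) (simp add: known_def split: if_splits)
      then show False using x by (simp add: coherent_iff_no_violation)
    qed
    then show "\<forall>n. restr x n \<in> coherence_tree p" by (simp add: coherence_tree_def)
  qed
  then show ?thesis by (simp add: tree_paths_def)
qed

text \<open>The strategy sought is the row of the empty sequence, which puts no constraint on the
  second player.\<close>

lemma FindWS_Sigma_le_UC_Baire: "FindWS_Sigma \<le>\<^sub>W UC_Baire"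
proof (rule weihrauch_leI)
  let ?H = "\<lambda>p n. if list_decode n \<in> coherence_tree p then 1 else 0 :: nat"
  let ?K = "\<lambda>s. strategy_at (bsnd s) []"
  show "recursive ?H"
    unfolding coherence_tree_def mem_Collect_eq violation_def surely_reaches_def surely_avoids_def
      surely_differ_def known_def secured_def answers_def target_def reply_def idx_def
    by (intro recursive_intros)
  show "recursive ?K"
    unfolding strategy_at_def idx_def bsnd_def by (intro recursive_intros)
  fix p W assume "in_rep FindWS_Sigma p = Some W" "W \<in> inputs FindWS_Sigma"
  then have W: "W = enum_open p" and "\<nexists>\<tau>. wins2 (enum_open p) \<tau>"
    by (auto simp: FindWS_Sigma_def open_rep_def)
  then have wf: "wf (extension_rel p)" by (intro wf_extension_rel)
  then obtain x where x: "coherent p x" using coherent_exists by blast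
  have paths: "tree_paths (coherence_tree p) = {x}"
    unfolding tree_paths_coherence_tree using coherent_unique[OF wf _ x] x by blast
  have "tree_rep (?H p) = Some (coherence_tree p)"
    by (simp add: tree_rep_def is_tree_coherence_tree)
  moreover have "wins1 W (strategy_at x [])"
    unfolding wins1_def W using strategy_at_wins[OF wf x] by (simp add: obeys_def)
  ultimately show "\<exists>y\<in>inputs UC_Baire. in_rep UC_Baire (?H p) = Some y \<and>
        (\<forall>r z. out_rep UC_Baire r = Some z \<longrightarrow> z \<in> solutions UC_Baire y \<longrightarrow>
          (\<exists>w. out_rep FindWS_Sigma (?K (bpair p r)) = Some w \<and> w \<in> solutions FindWS_Sigma W))"
    using paths by (auto simp: FindWS_Sigma_def UC_Baire_def baire_rep_def is_tree_coherence_tree)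
qed

theorem theorem6p21:
  "FindWS_Delta \<equiv>\<^sub>W Det_Delta \<and> Det_Delta \<equiv>\<^sub>W FindWS_Sigma \<and> FindWS_Sigma \<equiv>\<^sub>W UC_Baire"
  unfolding weihrauch_eq_def
  by (meson weihrauch_le_trans FindWS_Delta_le_Det_Delta Det_Delta_le_FindWS_Delta
      FindWS_Delta_le_FindWS_Sigma FindWS_Sigma_le_UC_Baire UC_Baire_le_FindWS_Delta)

end
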